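(* Let $H$ be a real finite-dimensional Hilbert space, let $\mu_A,\mu_B\in\mathbb{R}$, $L\ge 0$, let $A:H\to 2^H$ be maximal $\mu_A$-monotone, let $B:H\to H$ be $\mu_B$-monotone and $L$-Lipschitz continuous, and let $\lambda>0$ satisfy $1+\lambda\mu_A>0$ and $2(\mu_A+\mu_B)+\lambda\mu_A^2-\lambda L^2>0$. Let $c_1,c_2>0$. Then there exists $\varepsilon>0$ such that, for any $\kappa_1\in(1-\varepsilon,1)\cap(0,1)$ and any $\kappa_2>1$, the solution $x^*\in H$ of the inclusion problem $0\in A(x)+B(x)$ is a fixed-time stable equilibrium point of the dynamical system $$\dot x=-\varphi(x)\bigl(x-J_{\lambda A}(x-\lambda B(x))\bigr),$$ where $$\varphi(x)=\begin{cases}\dfrac{c_1}{\|x-J_{\lambda A}(x-\lambda B(x))\|^{1-\kappa_1}}+\dfrac{c_2}{\|x-J_{\lambda A}(x-\lambda B(x))\|^{1-\kappa_2}} & \text{if } x\in H\setminus \mathrm{Fix}(J_{\lambda A}\circ(\mathrm{Id}-\lambda B)),\\ 0&\text{otherwise,}\end{cases}$$ and the settling time satisfies, for all initial points $x(0)$, $$T(x(0))\le T_{\max}=\frac{1}{p_1(1-\alpha_1)}+\frac{1}{p_2(\alpha_2-1)}$$ for some constants $p_1>0$, $p_2>0$, $\alpha_1\in(0.5,1)$, $\alpha_2>1$ (independent of $x(0)$). In addition, if one takes $\alpha_1=1-\frac{1}{2\xi}$ and $\alpha_2=1+\frac{1}{2\xi}$ with $\xi>1$, then the following time estimate holds: $$T(x(0))\le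 T_{\max}=\frac{\pi\xi}{\sqrt{p_1p_2}}$$ for some constants $p_1>0$, $p_2>0$ and $\xi>1$.
   Context: For $\mu\in\mathbb{R}$ (possibly negative), an operator $A:H\to 2^H$ is $\mu$-monotone if $\langle x-y,u-v\rangle\ge\mu\|x-y\|^2$ for all $x,y\in H$, $u\in A(x)$, $v\in A(y)$; it is maximal $\mu$-monotone if moreover its graph $\{(x,u):u\in A(x)\}$ is not properly contained in the graph of any $\mu$-monotone operator. A single-valued $B:H\to H$ is regarded as the operator $x\mapsto\{B(x)\}$. The resolvent is $J_{\lambda A}=(\mathrm{Id}+\lambda A)^{-1}$; for $A$ maximal $\mu_A$-monotone and $1+\lambda\mu_A>0$ it is single-valued with domain $H$. $\mathrm{Fix}(S)$ denotes the set of fixed points of $S$. Stability notions for an autonomous system $\dot x(t)=G(x(t))$, $t\ge0$, with $G:H\to H$ continuous: $x^*$ is an equilibrium point if $G(x^* )=0$. It is (Lyapunov) stable if for every $\epsilon>0$ there is $r>0$ such that for every $x_0$ in the open ball of radius $r$ about $x^*$ the solution with $x(0)=x_0$ exists and stays in the open ball of radius $\epsilon$ about $x^*$ for all $t>0$. It is finite-time stable if it is stable and there are a neighborhood $N$ of $x^*$ and a settling-time function $T:N\setminus\{x^*\}\to(0,\infty)$ such that for every $x(0)\in N\setminus\{x^*\}$ the solution satisfies $x(t)\in N\setminus\{x^*\}$ for all $t\in[0,T(x(0)))$ and $\lim_{t\to T(x(0))}x(t)=x^*$. It is globally finite-time stable if this holds with $N=H$. It is fixed-time stable if it is globally finite-time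 stable and $\sup_{x(0)\in H} T(x(0))<\infty$. In the paper, the exponents in the time estimate arise as $\alpha_i=\frac{1+\kappa_i}{2}$ for $i=1,2$. *)

theory Defs
  imports "HOL-Analysis.Analysis"
begin

subsection \<open>Monotone operators and resolvents\<close>

definition operator_graph :: "('a \<Rightarrow> 'a set) \<Rightarrow> ('a \<times> 'a) set" where
  "operator_graph A = {(x, u). u \<in> A x}"

definition mu_monotone :: "real \<Rightarrow> ('a::real_inner \<Rightarrow> 'a set) \<Rightarrow> bool" where
  "mu_monotone \<mu> A \<longleftrightarrow>
     (\<forall>x y. \<forall>u\<in>A x. \<forall>v\<in>A y. inner (x - y) (u - v) \<ge> \<mu> * (norm (x - y))\<^sup>2)"

definition maximal_mu_monotone :: "real \<Rightarrow> ('a::real_inner \<Rightarrow> 'a set) \<Rightarrow> bool" where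
  "maximal_mu_monotone \<mu> A \<longleftrightarrow>
     mu_monotone \<mu> A \<and>
     \<not> (\<exists>A'. mu_monotone \<mu> A' \<and> operator_graph A \<subset> operator_graph A')"

definition resolvent_set :: "real \<Rightarrow> ('a::real_vector \<Rightarrow> 'a set) \<Rightarrow> 'a \<Rightarrow> 'a set" where
  "resolvent_set lam A z = {y. \<exists>u\<in>A y. z = y + lam *\<^sub>R u}"

text \<open>
  The set above is the value at \<open>z\<close> of the set-valued inverse of \<open>Id + lam A\<close>.
  The function below is its single-valued version; it is only meaningful when every
  such set is a singleton, which is the case for a maximal \<open>\<mu>\<close>-monotone
  operator with \<open>1 + lam * \<mu> > 0\<close>.
\<close>

definition resolvent :: "real \<Rightarrow> ('a::real_vector \<Rightarrow> 'a set) \<Rightarrow> 'a \<Rightarrow> 'a" where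
  "resolvent lam A z = (THE y. y \<in> resolvent_set lam A z)"

definition Fix :: "('a \<Rightarrow> 'a) \<Rightarrow> 'a set" where
  "Fix S = {x. S x = x}"


subsection \<open>Stability of autonomous systems\<close>

definition ode_solution :: "('a::real_normed_vector \<Rightarrow> 'a) \<Rightarrow> 'a \<Rightarrow> (real \<Rightarrow> 'a) \<Rightarrow> bool" where
  "ode_solution G x0 x \<longleftrightarrow>
     x 0 = x0 \<and> (\<forall>t\<ge>0. (x has_vector_derivative G (x t)) (at t within {0..}))"

text \<open>
  The notions below concern systems with a continuous right-hand side; continuity is
  recorded in the definition of an equilibrium point.  A clause about \<^emph>\<open>the\<close>
  solution from \<open>x0\<close> is rendered as: a solution on \<open>[0, \<infinity>)\<close>
  exists, and every such solution satisfies the clause.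
\<close>

definition equilibrium_point :: "('a::real_normed_vector \<Rightarrow> 'a) \<Rightarrow> 'a \<Rightarrow> bool" where
  "equilibrium_point G xs \<longleftrightarrow> continuous_on UNIV G \<and> G xs = 0"

definition lyapunov_stable :: "('a::real_normed_vector \<Rightarrow> 'a) \<Rightarrow> 'a \<Rightarrow> bool" where
  "lyapunov_stable G xs \<longleftrightarrow>
     (\<forall>\<epsilon>>0. \<exists>r>0. \<forall>x0\<in>ball xs r.
        (\<exists>x. ode_solution G x0 x) \<and>
        (\<forall>x. ode_solution G x0 x \<longrightarrow> (\<forall>t>0. x t \<in> ball xs \<epsilon>)))"

text \<open>Only the values of \<open>T\<close> on \<open>N - {xs}\<close> matter.\<close>

definition settling_time ::
  "('a::real_normed_vector \<Rightarrow> 'a) \<Rightarrow> 'a \<Rightarrow> 'a set \<Rightarrow> ('a \<Rightarrow> real) \<Rightarrow> bool" where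
  "settling_time G xs N T \<longleftrightarrow>
     (\<forall>x0\<in>N - {xs}.
        T x0 > 0 \<and>
        (\<exists>x. ode_solution G x0 x) \<and>
        (\<forall>x. ode_solution G x0 x \<longrightarrow>
           (\<forall>t\<in>{0..<T x0}. x t \<in> N - {xs}) \<and> (x \<longlongrightarrow> xs) (at (T x0))))"

definition finite_time_stable :: "('a::real_normed_vector \<Rightarrow> 'a) \<Rightarrow> 'a \<Rightarrow> bool" where
  "finite_time_stable G xs \<longleftrightarrow>
     lyapunov_stable G xs \<and> (\<exists>N T. xs \<in> interior N \<and> settling_time G xs N T)"

definition globally_finite_time_stable :: "('a::real_normed_vector \<Rightarrow> 'a) \<Rightarrow> 'a \<Rightarrow> bool" where
  "globally_finite_time_stable G xs \<longleftrightarrow>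
     lyapunov_stable G xs \<and> (\<exists>T. settling_time G xs UNIV T)"

definition fixed_time_stable :: "('a::real_normed_vector \<Rightarrow> 'a) \<Rightarrow> 'a \<Rightarrow> bool" where
  "fixed_time_stable G xs \<longleftrightarrow>
     globally_finite_time_stable G xs \<and>
     (\<exists>T. settling_time G xs UNIV T \<and> bdd_above (T ` (UNIV - {xs})))"


subsection \<open>The forward-backward dynamical system\<close>

definition fb_map :: "real \<Rightarrow> ('a::real_vector \<Rightarrow> 'a set) \<Rightarrow> ('a \<Rightarrow> 'a) \<Rightarrow> 'a \<Rightarrow> 'a" where
  "fb_map lam A B = resolvent lam A \<circ> (\<lambda>x. x - lam *\<^sub>R B x)"

definition fb_phi ::
  "real \<Rightarrow> real \<Rightarrow> real \<Rightarrow> real \<Rightarrow> real \<Rightarrow>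
   ('a::real_normed_vector \<Rightarrow> 'a set) \<Rightarrow> ('a \<Rightarrow> 'a) \<Rightarrow> 'a \<Rightarrow> real" where
  "fb_phi c1 c2 \<kappa>1 \<kappa>2 lam A B x =
     (if x \<notin> Fix (fb_map lam A B)
      then c1 / norm (x - fb_map lam A B x) powr (1 - \<kappa>1)
         + c2 / norm (x - fb_map lam A B x) powr (1 - \<kappa>2)
      else 0)"

definition fb_field ::
  "real \<Rightarrow> real \<Rightarrow> real \<Rightarrow> real \<Rightarrow> real \<Rightarrow>
   ('a::real_normed_vector \<Rightarrow> 'a set) \<Rightarrow> ('a \<Rightarrow> 'a) \<Rightarrow> 'a \<Rightarrow> 'a" where
  "fb_field c1 c2 \<kappa>1 \<kappa>2 lam A B x =
     - fb_phi c1 c2 \<kappa>1 \<kappa>2 lam A B x *\<^sub>R (x - fb_map lam A B x)"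

end

theory Submission
  imports Defs "HOL-Complex_Analysis.Great_Picard"
begin

text \<open>
  Write \<open>S\<close> for the forward-backward map. The gap condition says exactly that \<open>S\<close> is a strict
  contraction, so \<open>F = Id - S\<close> is strongly monotone and Lipschitz and vanishes only at the fixed
  point \<open>xs\<close> of \<open>S\<close>, the unique zero of \<open>A + B\<close>. Hence \<open>\<parallel>F x\<parallel>\<close> is comparable to \<open>\<parallel>x - xs\<parallel>\<close>, and
  \<open>V = \<parallel>x - xs\<parallel>\<^sup>2 / 2\<close> satisfies \<open>V' \<le> - p1 V\<^bsup>\<alpha>1\<^esup> - p2 V\<^bsup>\<alpha>2\<^esup>\<close> along trajectories for every \<open>\<kappa>1\<close> in \<open>(0, 1)\<close>,
  so \<open>\<epsilon> = 1\<close> works. Integrating this inequality bounds the time before \<open>xs\<close> is reached.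
  The field is not Lipschitz at \<open>xs\<close>: existence comes from Peano's theorem, while uniqueness
  holds up to the time of arrival at \<open>xs\<close>, where the trajectory stays; this makes the settling
  time depend on the initial point alone.
\<close>

subsection \<open>Minty's theorem and resolvents\<close>

text \<open>The inequality defining \<open>?H\<close> is symmetric in its two triples and affine in
  each, and monotonicity gives it for pairs from \<open>?Q\<close>. It extends to the hull one
  argument at a time; pairing \<open>(X, U, s)\<close> with itself gives
  \<open>2 * s - 2 * inner X U \<ge> 0\<close>.\<close>

lemma convex_hull_monotone_graph:
  fixes S :: "('a::real_inner \<times> 'a) set"
  assumes mono: "\<And>x u y v. (x, u) \<in> S \<Longrightarrow> (y, v) \<in> S \<Longrightarrow> inner (x - y) (u - v) \<ge> 0"
    and p: "(X, U, s) \<in> convex hull ((\<lambda>(x, u). (x, u, inner x u)) ` S)"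
  shows "inner X U \<le> s"
proof -
  let ?Q = "(\<lambda>(x, u). (x, u, inner x u)) ` S"
  let ?H = "\<lambda>Y V t. {(X, U, s). s + t - inner X V - inner Y U \<ge> (0::real)}"
  have conv: "convex (?H Y V t)" for Y V :: 'a and t :: real
  proof -
    have "?H Y V t = {p. inner (V, Y, -1) p \<le> t}"
      by (auto simp: inner_commute)
    then show ?thesis by (simp add: convex_halfspace_le)
  qed
  have 1: "(X, U, s) \<in> ?H y v (inner y v)" if "(y, v) \<in> S" for y v
  proof -
    have "?Q \<subseteq> ?H y v (inner y v)"
      using mono that by (fastforce simp: inner_diff inner_commute)
    then have "convex hull ?Q \<subseteq> ?H y v (inner y v)"
      by (rule hull_minimal) (rule conv)
    then show ?thesis using p by blast
  qed
  have "?Q \<subseteq> ?H X U s"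
    using 1 by (fastforce simp: inner_commute)
  then have "convex hull ?Q \<subseteq> ?H X U s"
    by (rule hull_minimal) (rule conv)
  with p have "(X, U, s) \<in> ?H X U s" by blast
  then show ?thesis by (simp add: inner_commute)
qed

text \<open>Minimising \<open>s + \<parallel>X - U\<parallel>\<^sup>2 / 4\<close> over the convex hull of the points \<open>(a, b, \<langle>a, b\<rangle>)\<close>
  replaces the usual appeal to a minimax or fixed point theorem: half of the minimiser's
  \<open>X - U\<close> is the required point, by the first-order condition.\<close>

lemma monotone_extension_finite:
  fixes S :: "('a::euclidean_space \<times> 'a) set"
  assumes "finite S"
    and mono: "\<And>x u y v. (x, u) \<in> S \<Longrightarrow> (y, v) \<in> S \<Longrightarrow> inner (x - y) (u - v) \<ge> 0"
  shows "\<exists>x. \<forall>(a, b)\<in>S. inner (a - x) (b + x) \<ge> 0"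
proof (cases "S = {}")
  case False
  let ?Q = "(\<lambda>(x, u). (x, u, inner x u)) ` S"
  define \<phi> where "\<phi> = (\<lambda>(X :: 'a, U :: 'a, s :: real). s + (norm (X - U))\<^sup>2 / 4)"
  have "compact (convex hull ?Q)"
    using assms(1) by (intro finite_imp_compact_convex_hull) auto
  moreover have "convex hull ?Q \<noteq> {}" using False by simp
  moreover have "continuous_on (convex hull ?Q) \<phi>"
    unfolding \<phi>_def case_prod_unfold by (intro continuous_intros) simp
  ultimately obtain p0 where p0: "p0 \<in> convex hull ?Q" "\<forall>q\<in>convex hull ?Q. \<phi> p0 \<le> \<phi> q"
    using continuous_attains_inf by blast
  obtain X U s where "p0 = (X, U, s)" by (rule prod_cases3)
  with p0 have p: "(X, U, s) \<in> convex hull ?Q"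
    and min: "\<And>q. q \<in> convex hull ?Q \<Longrightarrow> \<phi> (X, U, s) \<le> \<phi> q" by blast+
  have "inner X U \<le> s" using convex_hull_monotone_graph[OF mono p] .
  \<comment> \<open>Polarization: together with \<open>inner X U \<le> s\<close> the minimum of
    \<open>\<phi>\<close> is at least a square, hence nonnegative.\<close>
  moreover have "inner X U + (norm (X - U))\<^sup>2 / 4 = (norm (X + U))\<^sup>2 / 4"
    using dot_norm[of X U] dot_norm_neg[of X U] by (simp add: field_simps)
  ultimately have pos: "s + (norm (X - U))\<^sup>2 / 4 \<ge> 0"
    by (smt (verit) zero_le_power2 divide_nonneg_nonneg)
  have "inner (a - (1/2) *\<^sub>R (X - U)) (b + (1/2) *\<^sub>R (X - U)) \<ge> 0" if ab: "(a, b) \<in> S" for a b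
  proof -
    \<comment> \<open>\<open>d\<close> is the change of \<open>X - U\<close> on the way to
      \<open>(a, b, inner a b)\<close>, and \<open>c\<close> is the one-sided derivative of
      \<open>\<phi>\<close> in that direction, so minimality forces \<open>c \<ge> 0\<close>. The
      wanted inner product is \<open>c\<close> plus the minimum.\<close>
    define w where "w = X - U"
    define d where "d = (a - b) - w"
    define c where "c = (inner a b - s) + inner w d / 2"
    have q: "(a, b, inner a b) \<in> convex hull ?Q"
      using ab by (intro hull_inc) force
    have step: "0 \<le> c + t * ((norm d)\<^sup>2 / 4)" if t: "0 < t" "t \<le> 1" for t
    proof -
      have "(1 - t) *\<^sub>R (X, U, s) + t *\<^sub>R (a, b, inner a b) \<in> convex hull ?Q"
        using t by (intro convexD[OF convex_convex_hull p q]) auto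
      from min[OF this] have
        "s + (norm w)\<^sup>2 / 4 \<le> ((1 - t) * s + t * inner a b) + (norm (w + t *\<^sub>R d))\<^sup>2 / 4"
        by (simp add: \<phi>_def d_def w_def algebra_simps)
      also have "(norm (w + t *\<^sub>R d))\<^sup>2 = (norm w)\<^sup>2 + 2 * t * inner w d + t\<^sup>2 * (norm d)\<^sup>2"
        unfolding power2_norm_eq_inner
        by (simp add: inner_simps inner_commute power2_eq_square algebra_simps)
      finally have "0 \<le> t * (c + t * ((norm d)\<^sup>2 / 4))"
        by (simp add: c_def algebra_simps power2_eq_square add_divide_distrib)
      then show ?thesis using t by (simp add: zero_le_mult_iff)
    qed
    have "0 \<le> c"
    proof (rule tendsto_lowerbound)
      show "((\<lambda>t. c + t * ((norm d)\<^sup>2 / 4)) \<longlongrightarrow> c) (at_right 0)"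
        by (rule tendsto_eq_intros refl | simp)+
      show "\<forall>\<^sub>F t in at_right 0. 0 \<le> c + t * ((norm d)\<^sup>2 / 4)"
        unfolding eventually_at_right_field by (intro exI[of _ 1]) (use step in auto)
    qed simp
    moreover have "inner (a - (1/2) *\<^sub>R w) (b + (1/2) *\<^sub>R w) = c + (s + (norm w)\<^sup>2 / 4)"
      by (simp add: c_def d_def power2_norm_eq_inner inner_simps inner_commute
          add_divide_distrib diff_divide_distrib algebra_simps)
    ultimately show ?thesis using pos by (simp add: w_def)
  qed
  then show ?thesis by blast
qed auto

text \<open>Each condition puts \<open>x\<close> into the closed ball with diameter from
  \<open>a\<close> to \<open>- b\<close>. Balls are compact here, so the finite intersection
  property reduces the claim to finite sets.\<close>

lemma monotone_extension:
  fixes S :: "('a::euclidean_space \<times> 'a) set"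
  assumes mono: "\<And>x u y v. (x, u) \<in> S \<Longrightarrow> (y, v) \<in> S \<Longrightarrow> inner (x - y) (u - v) \<ge> 0"
  shows "\<exists>x. \<forall>(a, b)\<in>S. inner (a - x) (b + x) \<ge> 0"
proof (cases "S = {}")
  case False
  define C where "C = (\<lambda>(a :: 'a, b :: 'a). cball ((1/2) *\<^sub>R (a - b)) (norm (a + b) / 2))"
  have C: "x \<in> C (a, b) \<longleftrightarrow> inner (a - x) (b + x) \<ge> 0" for a b x
  proof -
    define c where "c = (1/2) *\<^sub>R (a + b)"
    define d where "d = (1/2) *\<^sub>R (a - b) - x"
    have half: "(1/2) *\<^sub>R y + (1/2) *\<^sub>R y = y" for y :: 'a
      by (simp flip: scaleR_add_left)
    have "a - x = c + d" "b + x = c - d"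
      using half[of a] half[of b] by (simp_all add: c_def d_def scaleR_add_right scaleR_diff_right)
    then have "inner (a - x) (b + x) = (norm c)\<^sup>2 - (norm d)\<^sup>2"
      by (simp add: power2_norm_eq_inner inner_simps inner_commute)
    moreover have "norm c = norm (a + b) / 2" by (simp add: c_def)
    ultimately have "(norm ((1/2) *\<^sub>R (a - b) - x))\<^sup>2 = (norm (a + b) / 2)\<^sup>2 - inner (a - x) (b + x)"
      by (simp add: d_def)
    moreover have "x \<in> C (a, b) \<longleftrightarrow> (norm ((1/2) *\<^sub>R (a - b) - x))\<^sup>2 \<le> (norm (a + b) / 2)\<^sup>2"
      using abs_le_square_iff[of "norm ((1/2) *\<^sub>R (a - b) - x)" "norm (a + b) / 2"]
      by (simp add: C_def dist_norm)
    ultimately show ?thesis by simp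
  qed
  from False obtain p where p: "p \<in> S" by blast
  \<comment> \<open>\<open>C p\<close> serves as the compact ambient set, hence
    \<open>insert p S'\<close> in the finite case.\<close>
  have "C p \<inter> \<Inter> (C ` S) \<noteq> {}"
  proof (rule compact_imp_fip)
    show "compact (C p)" by (auto simp: C_def split: prod.split)
    show "closed T" if "T \<in> C ` S" for T using that by (auto simp: C_def)
    fix F assume F: "finite F" "F \<subseteq> C ` S"
    then obtain S' where S': "S' \<subseteq> S" "finite S'" "F = C ` S'"
      by (meson finite_subset_image)
    have "\<exists>x. \<forall>(a, b)\<in>insert p S'. inner (a - x) (b + x) \<ge> 0"
      using S' p by (intro monotone_extension_finite mono) auto
    then obtain x where "\<forall>(a, b)\<in>insert p S'. inner (a - x) (b + x) \<ge> 0" by blast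
    then have "x \<in> C q" if "q \<in> insert p S'" for q
      using that by (cases q) (auto simp: C)
    then show "C p \<inter> \<Inter> F \<noteq> {}" using S' by blast
  qed
  then obtain x where "\<And>q. q \<in> S \<Longrightarrow> x \<in> C q" by auto
  then show ?thesis using C by blast
qed auto

section \<open>Resolvents of maximal \<mu>-monotone operators\<close>

lemma resolvent_set_inner_bound:
  assumes "mu_monotone \<mu> A" "lam > 0"
    and "y \<in> resolvent_set lam A z" "y' \<in> resolvent_set lam A z'"
  shows "(1 + lam * \<mu>) * (norm (y - y'))\<^sup>2 \<le> inner (y - y') (z - z')"
proof -
  obtain u u' where u: "u \<in> A y" "z = y + lam *\<^sub>R u" "u' \<in> A y'" "z' = y' + lam *\<^sub>R u'"
    using assms(3,4) by (auto simp: resolvent_set_def)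
  have "lam * (\<mu> * (norm (y - y'))\<^sup>2) \<le> lam * inner (y - y') (u - u')"
    using assms(1,2) u by (auto simp: mu_monotone_def)
  moreover have "inner (y - y') (z - z') = (norm (y - y'))\<^sup>2 + lam * inner (y - y') (u - u')"
    by (simp add: u power2_norm_eq_inner algebra_simps)
  ultimately show ?thesis by (simp add: algebra_simps)
qed

text \<open>The extension lemma produces a pair that is \<mu>-monotonically related to the graph of
  \<open>A\<close>, and maximality puts this pair into the graph. Uniqueness is strong monotonicity
  of \<open>Id + lam A\<close>.\<close>

theorem resolvent_set_singleton:
  fixes A :: "'a::euclidean_space \<Rightarrow> 'a set"
  assumes max: "maximal_mu_monotone \<mu> A" and "lam > 0" and "1 + lam * \<mu> > 0"
  shows "\<exists>y. resolvent_set lam A z = {y}"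
proof -
  define \<beta> where "\<beta> = 1 + lam * \<mu>"
  have \<beta>: "\<beta> > 0" using assms(3) by (simp add: \<beta>_def)
  have mono: "mu_monotone \<mu> A" using max by (simp add: maximal_mu_monotone_def)
  \<comment> \<open>\<open>A - \<mu> Id\<close> is monotone. The scaling by
    \<open>lam / \<beta>\<close> and the shift by \<open>z / \<beta>\<close> are chosen so that the
    second component plus \<open>x\<close> becomes \<open>lam / \<beta>\<close> times
    \<open>(b - u) - \<mu> (a - x)\<close>, where \<open>u\<close> solves
    \<open>z = x + lam u\<close>.\<close>
  define S where "S = {(a, (lam / \<beta>) *\<^sub>R (b - \<mu> *\<^sub>R a) - (1 / \<beta>) *\<^sub>R z) | a b. b \<in> A a}"
  have "\<exists>x. \<forall>(a, b)\<in>S. inner (a - x) (b + x) \<ge> 0"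
  proof (rule monotone_extension)
    fix x u y v assume "(x, u) \<in> S" "(y, v) \<in> S"
    then obtain b b' where b: "b \<in> A x" "u = (lam / \<beta>) *\<^sub>R (b - \<mu> *\<^sub>R x) - (1 / \<beta>) *\<^sub>R z"
      "b' \<in> A y" "v = (lam / \<beta>) *\<^sub>R (b' - \<mu> *\<^sub>R y) - (1 / \<beta>) *\<^sub>R z"
      by (auto simp: S_def)
    have "u - v = (lam / \<beta>) *\<^sub>R ((b - b') - \<mu> *\<^sub>R (x - y))"
      by (simp add: b algebra_simps)
    then have "inner (x - y) (u - v) = (lam / \<beta>) * (inner (x - y) (b - b') - \<mu> * (norm (x - y))\<^sup>2)"
      by (simp add: power2_norm_eq_inner inner_diff_right)
    also have "\<dots> \<ge> 0"
      using mono b \<beta> assms(2) by (auto simp: mu_monotone_def)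
    finally show "inner (x - y) (u - v) \<ge> 0" .
  qed
  then obtain x where x: "\<And>a b. b \<in> A a \<Longrightarrow>
      inner (a - x) ((lam / \<beta>) *\<^sub>R (b - \<mu> *\<^sub>R a) - (1 / \<beta>) *\<^sub>R z + x) \<ge> 0"
    by (fastforce simp: S_def)
  define u where "u = (1 / lam) *\<^sub>R (z - x)"
  have zx: "z = x + lam *\<^sub>R u" using assms(2) by (simp add: u_def)
  have rel: "inner (a - x) (b - u) \<ge> \<mu> * (norm (a - x))\<^sup>2" if "b \<in> A a" for a b
  proof -
    have "\<beta> *\<^sub>R ((lam / \<beta>) *\<^sub>R (b - \<mu> *\<^sub>R a) - (1 / \<beta>) *\<^sub>R z + x)
        = lam *\<^sub>R (b - \<mu> *\<^sub>R a) - z + \<beta> *\<^sub>R x"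
      using \<beta> by (simp add: algebra_simps)
    also have "\<dots> = lam *\<^sub>R ((b - u) - \<mu> *\<^sub>R (a - x))"
      by (simp add: zx \<beta>_def algebra_simps)
    finally have *: "(lam / \<beta>) *\<^sub>R (b - \<mu> *\<^sub>R a) - (1 / \<beta>) *\<^sub>R z + x
        = (lam / \<beta>) *\<^sub>R ((b - u) - \<mu> *\<^sub>R (a - x))"
      using \<beta> by (metis (no_types, lifting) divide_inverse_commute less_irrefl scaleR_scaleR
          left_inverse scaleR_one)
    have "0 \<le> (lam / \<beta>) * (inner (a - x) (b - u) - \<mu> * (norm (a - x))\<^sup>2)"
      using x[OF that] unfolding * by (simp add: power2_norm_eq_inner inner_diff_right)
    then show ?thesis using \<beta> assms(2) by (simp add: zero_le_mult_iff zero_le_divide_iff)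
  qed
  have "u \<in> A x"
  proof (rule ccontr)
    assume u: "u \<notin> A x"
    \<comment> \<open>Adding the single pair \<open>(x, u)\<close> keeps \<mu>-monotonicity by
      \<open>rel\<close>, which contradicts maximality.\<close>
    define A' where "A' = A(x := insert u (A x))"
    have "mu_monotone \<mu> A'"
      unfolding mu_monotone_def
    proof (intro allI ballI)
      fix a a' b b' assume "b \<in> A' a" "b' \<in> A' a'"
      then consider "b \<in> A a" "b' \<in> A a'" | "b \<in> A a" "a' = x" "b' = u"
        | "b' \<in> A a'" "a = x" "b = u" | "a = x" "b = u" "a' = x" "b' = u"
        by (auto simp: A'_def split: if_splits)
      then show "\<mu> * (norm (a - a'))\<^sup>2 \<le> inner (a - a') (b - b')"
      proof cases
        case 1 then show ?thesis using mono by (auto simp: mu_monotone_def)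
      next
        case 2 then show ?thesis using rel by auto
      next
        case 3
        have "inner (x - a') (u - b') = inner (a' - x) (b' - u)" by (simp add: inner_diff)
        with 3 show ?thesis using rel[OF 3(1)] by (simp add: norm_minus_commute)
      qed simp
    qed
    moreover have "operator_graph A \<subset> operator_graph A'"
      using u by (force simp: operator_graph_def A'_def psubset_eq)
    ultimately show False using max by (auto simp: maximal_mu_monotone_def)
  qed
  then have x_in: "x \<in> resolvent_set lam A z" using zx by (auto simp: resolvent_set_def)
  moreover have "y = x" if "y \<in> resolvent_set lam A z" for y
  proof -
    have "\<beta> * (norm (y - x))\<^sup>2 \<le> 0"
      using resolvent_set_inner_bound[OF mono assms(2) that x_in] by (simp add: \<beta>_def)
    then show ?thesis using \<beta> by (simp add: mult_le_0_iff)
  qed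
  ultimately show ?thesis by blast
qed

lemma resolvent_eq_iff:
  fixes A :: "'a::euclidean_space \<Rightarrow> 'a set"
  assumes "maximal_mu_monotone \<mu> A" "lam > 0" "1 + lam * \<mu> > 0"
  shows "resolvent lam A z = y \<longleftrightarrow> y \<in> resolvent_set lam A z"
proof -
  obtain w where w: "resolvent_set lam A z = {w}"
    using resolvent_set_singleton[OF assms] by blast
  then have "resolvent lam A z = w" by (simp add: resolvent_def)
  with w show ?thesis by auto
qed

lemma resolvent_lipschitz:
  fixes A :: "'a::euclidean_space \<Rightarrow> 'a set"
  assumes "maximal_mu_monotone \<mu> A" "lam > 0" "1 + lam * \<mu> > 0"
  shows "(1 + lam * \<mu>) * norm (resolvent lam A z - resolvent lam A z') \<le> norm (z - z')"
proof -
  let ?y = "resolvent lam A z" and ?y' = "resolvent lam A z'"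
  have "?y \<in> resolvent_set lam A z" "?y' \<in> resolvent_set lam A z'"
    using resolvent_eq_iff[OF assms] by blast+
  then have "(1 + lam * \<mu>) * (norm (?y - ?y'))\<^sup>2 \<le> inner (?y - ?y') (z - z')"
    using assms(1,2) by (intro resolvent_set_inner_bound) (auto simp: maximal_mu_monotone_def)
  also have "\<dots> \<le> norm (?y - ?y') * norm (z - z')" by (rule norm_cauchy_schwarz)
  finally have "norm (?y - ?y') * ((1 + lam * \<mu>) * norm (?y - ?y')) \<le> norm (?y - ?y') * norm (z - z')"
    by (simp add: power2_eq_square mult_ac)
  then show ?thesis by (cases "?y = ?y'") auto
qed

subsection \<open>Peano's theorem\<close>

primrec euler_node :: "('a::real_normed_vector \<Rightarrow> 'a) \<Rightarrow> real \<Rightarrow> 'a \<Rightarrow> nat \<Rightarrow> 'a" where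
  "euler_node g h x0 0 = x0"
| "euler_node g h x0 (Suc k) = euler_node g h x0 k + h *\<^sub>R g (euler_node g h x0 k)"

definition euler_path :: "('a::real_normed_vector \<Rightarrow> 'a) \<Rightarrow> real \<Rightarrow> 'a \<Rightarrow> real \<Rightarrow> 'a" where
  "euler_path g h x0 t =
     (let k = nat \<lfloor>t / h\<rfloor> in euler_node g h x0 k + (t - real k * h) *\<^sub>R g (euler_node g h x0 k))"

text \<open>At the right endpoint the floor already selects the next cell; at offset zero that cell
  gives the next node, which agrees by the Euler recursion. So both closed cells describe a shared
  node.\<close>

lemma euler_path_cell:
  assumes "h > 0" "real k * h \<le> t" "t \<le> real (Suc k) * h"
  shows "euler_path g h x0 t = euler_node g h x0 k + (t - real k * h) *\<^sub>R g (euler_node g h x0 k)"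
proof (cases "t = real (Suc k) * h")
  case True
  then have "t / h = of_int (int (Suc k))" using assms(1) by simp
  then have "\<lfloor>t / h\<rfloor> = int (Suc k)" by (metis floor_of_int)
  then have "nat \<lfloor>t / h\<rfloor> = Suc k" by simp
  then show ?thesis by (simp add: euler_path_def True algebra_simps)
next
  case False
  then have "\<lfloor>t / h\<rfloor> = int k"
    using assms by (intro floor_unique) (auto simp: field_simps)
  then show ?thesis by (simp add: euler_path_def)
qed

lemma euler_path_node: "h > 0 \<Longrightarrow> euler_path g h x0 (real k * h) = euler_node g h x0 k"
  by (subst euler_path_cell[of _ k]) auto

text \<open>On each cell the slope is the value of \<open>g\<close> at the left node. That node can
  precede \<open>u\<close> by up to one step, whence the window starting at \<open>u - h\<close>.
  Taking \<open>w = 0\<close> gives a common Lipschitz constant; taking \<open>w = g (x t)\<close>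
  gives the derivative of a limit path.\<close>

lemma euler_path_increment:
  assumes h: "h > 0" and uv: "0 \<le> u" "u \<le> v"
    and slope: "\<And>r. 0 \<le> r \<Longrightarrow> u - h \<le> r \<Longrightarrow> r \<le> v \<Longrightarrow> norm (g (euler_path g h x0 r) - w) \<le> e"
  shows "norm (euler_path g h x0 v - euler_path g h x0 u - (v - u) *\<^sub>R w) \<le> (v - u) * e"
proof -
  let ?P = "euler_path g h x0"
  have cell: "norm (?P b - ?P a - (b - a) *\<^sub>R w) \<le> (b - a) * e"
    if "real m * h \<le> a" "a \<le> b" "b \<le> real (Suc m) * h" "u \<le> a" "b \<le> v" for a b m
  proof -
    have "?P b - ?P a - (b - a) *\<^sub>R w = (b - a) *\<^sub>R (g (?P (real m * h)) - w)"
      using that h by (simp add: euler_path_cell[of _ m] euler_path_node algebra_simps)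
    moreover have "norm (g (?P (real m * h)) - w) \<le> e"
      using that h by (intro slope) (auto simp: algebra_simps)
    ultimately show ?thesis using that(2) by (simp add: mult_left_mono)
  qed
  have "norm (?P b - ?P u - (b - u) *\<^sub>R w) \<le> (b - u) * e"
    if "real m * h \<le> b" "u \<le> b" "b \<le> real (Suc m) * h" "b \<le> v" for b m
    using that
  proof (induction m arbitrary: b)
    case 0
    then show ?case using uv by (intro cell[of 0]) auto
  next
    case (Suc m)
    show ?case
    \<comment> \<open>Either \<open>u\<close> lies in the current cell, or the increment splits at
      the left node of that cell and the induction hypothesis covers the earlier part.\<close>
    proof (cases "real (Suc m) * h \<le> u")
      case True
      then show ?thesis using Suc.prems by (intro cell[of "Suc m"]) auto
    next
      case False
      let ?c = "real (Suc m) * h"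
      have 1: "norm (?P ?c - ?P u - (?c - u) *\<^sub>R w) \<le> (?c - u) * e"
        using False Suc.prems h by (intro Suc.IH) (auto simp: algebra_simps)
      have 2: "norm (?P b - ?P ?c - (b - ?c) *\<^sub>R w) \<le> (b - ?c) * e"
        using False Suc.prems by (intro cell[of "Suc m"]) auto
      have "?P b - ?P u - (b - u) *\<^sub>R w
          = (?P ?c - ?P u - (?c - u) *\<^sub>R w) + (?P b - ?P ?c - (b - ?c) *\<^sub>R w)"
        by (simp add: algebra_simps)
      then have "norm (?P b - ?P u - (b - u) *\<^sub>R w) \<le> (?c - u) * e + (b - ?c) * e"
        using norm_triangle_le[OF add_mono[OF 1 2]] by metis
      then show ?thesis by (simp add: algebra_simps)
    qed
  qed
  moreover obtain m :: nat where "real m * h \<le> v" "v \<le> real (Suc m) * h"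
  proof
    have "0 \<le> v / h" using uv h by simp
    then have "real (nat \<lfloor>v / h\<rfloor>) \<le> v / h" "v / h \<le> real (Suc (nat \<lfloor>v / h\<rfloor>))"
      by linarith+
    then show "real (nat \<lfloor>v / h\<rfloor>) * h \<le> v" "v \<le> real (Suc (nat \<lfloor>v / h\<rfloor>)) * h"
      using h by (simp_all add: field_simps)
  qed
  ultimately show ?thesis using uv by blast
qed

lemma euler_path_lipschitz:
  assumes "h > 0" "0 \<le> u" "0 \<le> v" and "\<And>x. norm (g x) \<le> M"
  shows "norm (euler_path g h x0 v - euler_path g h x0 u) \<le> M * \<bar>v - u\<bar>"
proof (cases "u \<le> v")
  case True
  then show ?thesis
    using euler_path_increment[of h u v g x0 0 M] assms by (simp add: mult.commute)
next
  case False
  then show ?thesis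
    using euler_path_increment[of h v u g x0 0 M] assms by (simp add: mult.commute norm_minus_commute)
qed

text \<open>Euler polygons of shrinking step share the Lipschitz constant \<open>M\<close>, so by
  Arzela-Ascoli a subsequence converges uniformly; the increment estimate passes to the limit and
  identifies its derivative.\<close>

theorem peano_bounded:
  fixes g :: "'a::euclidean_space \<Rightarrow> 'a"
  assumes cont: "continuous_on UNIV g" and bnd: "\<And>x. norm (g x) \<le> M"
  obtains x where "x 0 = x0"
    and "\<And>t. t \<in> {0..T} \<Longrightarrow> (x has_vector_derivative g (x t)) (at t within {0..T})"
proof -
  define h where "h = (\<lambda>n. inverse (real (Suc n)))"
  define P where "P = (\<lambda>n. euler_path g (h n) x0)"
  have h: "h n > 0" for n by (simp add: h_def)
  have h0: "h \<longlonglongrightarrow> 0" unfolding h_def by (rule LIMSEQ_inverse_real_of_nat)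
  have M: "M \<ge> 0" using bnd[of 0] norm_ge_zero order_trans by blast
  have P0: "P n 0 = x0" for n
    using euler_path_node[OF h, of g _ x0 0] by (simp add: P_def)
  have lip: "norm (P n v - P n u) \<le> M * \<bar>v - u\<bar>" if "0 \<le> u" "0 \<le> v" for n u v
    unfolding P_def using h that bnd by (rule euler_path_lipschitz)
  obtain x :: "real \<Rightarrow> 'a" and k where k: "strict_mono (k :: nat \<Rightarrow> nat)"
    and unif: "\<And>e. 0 < e \<Longrightarrow> \<exists>N. \<forall>n t. n \<ge> N \<and> t \<in> {0..T} \<longrightarrow> norm (P (k n) t - x t) < e"
  proof (rule Arzela_Ascoli[of "{0..T}" P "norm x0 + M * \<bar>T\<bar>"])
    show "norm (P n t) \<le> norm x0 + M * \<bar>T\<bar>" if "t \<in> {0..T}" for n t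
    proof -
      have "norm (P n t) \<le> norm x0 + norm (P n t - P n 0)"
        using norm_triangle_sub[of "P n t" x0] by (simp add: P0)
      also have "norm (P n t - P n 0) \<le> M * \<bar>t - 0\<bar>" using that by (intro lip) auto
      also have "\<dots> \<le> M * \<bar>T\<bar>" using that M by (intro mult_left_mono) auto
      finally show ?thesis by simp
    qed
    fix t e :: real assume t: "t \<in> {0..T}" and e: "0 < e"
    show "\<exists>d>0. \<forall>n y. y \<in> {0..T} \<and> norm (t - y) < d \<longrightarrow> norm (P n t - P n y) < e"
    \<comment> \<open>\<open>M + 1\<close> in place of \<open>M\<close> covers the case
      \<open>M = 0\<close>.\<close>
    proof (intro exI[of _ "e / (M + 1)"] conjI allI impI)
      fix n y assume y: "y \<in> {0..T} \<and> norm (t - y) < e / (M + 1)"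
      have "norm (P n t - P n y) \<le> M * \<bar>t - y\<bar>" using y t by (intro lip) auto
      also have "\<dots> \<le> (M + 1) * \<bar>t - y\<bar>" by (intro mult_right_mono) auto
      also have "\<dots> < e" using y M by (simp add: field_simps)
      finally show "norm (P n t - P n y) < e" .
    qed (use e M in auto)
  qed auto
  have lim: "(\<lambda>n. P (k n) t) \<longlonglongrightarrow> x t" if "t \<in> {0..T}" for t
    unfolding LIMSEQ_iff using unif that by blast
  have hk: "(\<lambda>n. h (k n)) \<longlonglongrightarrow> 0"
    using LIMSEQ_subseq_LIMSEQ[OF h0 k] by (simp add: o_def)
  have main: "(x has_vector_derivative g (x t)) (at t within {0..T})" if t: "t \<in> {0..T}" for t
    unfolding has_vector_derivative_def has_derivative_within_alt
  proof (intro conjI allI impI bounded_linear_scaleR_left)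
    fix e :: real assume e: "e > 0"
    obtain \<delta> where \<delta>: "\<delta> > 0" "\<And>y. norm (y - x t) < \<delta> \<Longrightarrow> norm (g y - g (x t)) < e"
      using cont e unfolding continuous_on_iff dist_norm by (metis UNIV_I)
    show "\<exists>d>0. \<forall>s\<in>{0..T}. norm (s - t) < d \<longrightarrow>
        norm (x s - x t - (s - t) *\<^sub>R g (x t)) \<le> e * norm (s - t)"
    \<comment> \<open>\<open>\<delta>\<close> is split in three: motion over the time
      \<open>\<bar>s - t\<bar>\<close>, motion over one step, and distance to the limit at
      \<open>t\<close>. All polygon values in the slope window then lie within
      \<open>\<delta>\<close> of \<open>x t\<close>.\<close>
    proof (intro exI[of _ "\<delta> / (3 * (M + 1))"] conjI ballI impI)
      fix s assume s: "s \<in> {0..T}" and st: "norm (s - t) < \<delta> / (3 * (M + 1))"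
      define u v where "u = min s t" and "v = max s t"
      have uv: "u \<in> {0..T}" "v \<in> {0..T}" "u \<le> v" using s t by (auto simp: u_def v_def)
      have Mst: "M * \<bar>s - t\<bar> < \<delta> / 3"
      proof -
        have "M * \<bar>s - t\<bar> \<le> (M + 1) * \<bar>s - t\<bar>" by (intro mult_right_mono) auto
        also have "\<dots> < \<delta> / 3" using st M by (simp add: field_simps)
        finally show ?thesis .
      qed
      have "(\<lambda>n. M * h (k n)) \<longlonglongrightarrow> 0" using tendsto_mult_right_zero[OF hk] by simp
      then have "\<forall>\<^sub>F n in sequentially. M * h (k n) < \<delta> / 3"
        using \<delta>(1) by (intro order_tendstoD(2)) auto
      moreover have "\<forall>\<^sub>F n in sequentially. dist (P (k n) t) (x t) < \<delta> / 3"
        using lim[OF t] \<delta>(1) by (intro tendstoD) auto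
      ultimately have ev: "\<forall>\<^sub>F n in sequentially.
          norm (P (k n) v - P (k n) u - (v - u) *\<^sub>R g (x t)) \<le> (v - u) * e"
      proof eventually_elim
        case (elim n)
        show ?case unfolding P_def
        proof (rule euler_path_increment[OF h])
          fix r assume r: "0 \<le> r" "u - h (k n) \<le> r" "r \<le> v"
          have "norm (P (k n) r - P (k n) t) \<le> M * \<bar>r - t\<bar>" using r t by (intro lip) auto
          also have "\<dots> \<le> M * (\<bar>s - t\<bar> + h (k n))"
            using r h[of "k n"] M by (intro mult_left_mono) (auto simp: u_def v_def)
          also have "\<dots> < \<delta> / 3 + \<delta> / 3" using Mst elim(1) by (simp add: algebra_simps)
          finally have "norm (P (k n) r - x t) < \<delta>"
            using elim(2) norm_triangle_ineq[of "P (k n) r - P (k n) t" "P (k n) t - x t"]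
            by (simp add: dist_norm)
          then show "norm (g (euler_path g (h (k n)) x0 r) - g (x t)) \<le> e"
            using \<delta>(2) by (force simp: P_def)
        qed (use uv in auto)
      qed
      have "norm (x v - x u - (v - u) *\<^sub>R g (x t)) \<le> (v - u) * e"
        by (rule tendsto_upperbound[OF _ ev]) (intro tendsto_intros lim uv, simp)
      moreover have "norm (x s - x t - (s - t) *\<^sub>R g (x t)) = norm (x v - x u - (v - u) *\<^sub>R g (x t))"
      proof (cases "t \<le> s")
        case False
        have "x s - x t - (s - t) *\<^sub>R g (x t) = - (x t - x s - (t - s) *\<^sub>R g (x t))"
          by (simp add: algebra_simps)
        then have "norm (x s - x t - (s - t) *\<^sub>R g (x t)) = norm (x t - x s - (t - s) *\<^sub>R g (x t))"
          by (metis norm_minus_cancel)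
        then show ?thesis using False by (simp add: u_def v_def)
      qed (simp add: u_def v_def)
      moreover have "v - u = norm (s - t)" by (auto simp: u_def v_def)
      ultimately show "norm (x s - x t - (s - t) *\<^sub>R g (x t)) \<le> e * norm (s - t)"
        by (simp add: mult.commute)
    qed (use \<delta>(1) M in auto)
  qed
  show ?thesis
  proof (cases "T \<ge> 0")
    case True
    then have "x 0 = x0" using LIMSEQ_unique[OF lim[of 0]] by (simp add: P0)
    then show ?thesis using main that by blast
  next
    \<comment> \<open>For negative \<open>T\<close> the interval is empty, so any function starting
      at \<open>x0\<close> serves.\<close>
    case False
    then show ?thesis using that[of "\<lambda>_. x0"] by auto
  qed
qed

subsection \<open>Fixed-time estimates for scalar differential inequalities\<close>

lemma increment_le_of_derivative_le:
  fixes f :: "real \<Rightarrow> real"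
  assumes "a \<le> b"
    and "\<And>t. t \<in> {a..b} \<Longrightarrow> (f has_real_derivative f' t) (at t within {a..b})"
    and "\<And>t. t \<in> {a..b} \<Longrightarrow> f' t \<le> c"
  shows "f b - f a \<le> c * (b - a)"
proof (cases "a = b")
  case False
  then have "\<exists>t\<in>{a<..<b}. f b - f a = f' t * (b - a)"
    using assms(1,2) by (intro mvt_simple[where f' = "\<lambda>t. (*) (f' t)"]) (auto simp: has_field_derivative_def)
  then obtain t where "t \<in> {a<..<b}" "f b - f a = f' t * (b - a)" by blast
  then show ?thesis using assms(1) assms(3)[of t] by (auto intro!: mult_right_mono)
qed simp

lemma half_sq_norm_has_derivative:
  assumes "(x has_vector_derivative v) (at t within S)"
  shows "((\<lambda>t. (norm (x t - p))\<^sup>2 / 2) has_real_derivative inner (x t - p) v) (at t within S)"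
proof -
  have "((\<lambda>t. x t - p) has_derivative (\<lambda>s. s *\<^sub>R v)) (at t within S)"
    using assms unfolding has_vector_derivative_def by (auto intro!: derivative_eq_intros)
  from has_derivative_inner[OF this this]
  have "((\<lambda>t. inner (x t - p) (x t - p) * (1/2)) has_derivative
      (\<lambda>s. (inner (x t - p) (s *\<^sub>R v) + inner (s *\<^sub>R v) (x t - p)) * (1/2))) (at t within S)"
    by (rule has_derivative_mult_left)
  moreover have "(\<lambda>s. (inner (x t - p) (s *\<^sub>R v) + inner (s *\<^sub>R v) (x t - p)) * (1/2)) = (*) (inner (x t - p) v)"
    by (auto simp: fun_eq_iff inner_commute)
  ultimately show ?thesis
    by (simp add: has_field_derivative_def power2_norm_eq_inner)
qed

text \<open>Separation of variables: \<open>\<Phi>\<close> is an antiderivative of the weight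
  \<open>\<phi>\<close>, and \<open>c \<le> \<phi> v * d v\<close> makes \<open>\<Phi> (V t)\<close>
  fall at rate at least \<open>c\<close>.\<close>

lemma scalar_comparison:
  fixes V :: "real \<Rightarrow> real"
  assumes "a \<le> b"
    and V: "\<And>t. t \<in> {a..b} \<Longrightarrow> (V has_real_derivative V' t) (at t within {a..b})"
    and pos: "\<And>t. t \<in> {a..b} \<Longrightarrow> V t > 0"
    and decay: "\<And>t. t \<in> {a..b} \<Longrightarrow> V' t \<le> - d (V t)"
    and \<Phi>: "\<And>v. v > 0 \<Longrightarrow> (\<Phi> has_real_derivative \<phi> v) (at v)"
    and \<phi>: "\<And>v. v > 0 \<Longrightarrow> \<phi> v \<ge> 0" "\<And>v. v > 0 \<Longrightarrow> c \<le> \<phi> v * d v"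
  shows "\<Phi> (V b) \<le> \<Phi> (V a) - c * (b - a)"
proof -
  have "\<Phi> (V b) - \<Phi> (V a) \<le> - c * (b - a)"
  proof (rule increment_le_of_derivative_le[OF assms(1)])
    fix t assume t: "t \<in> {a..b}"
    show "((\<lambda>t. \<Phi> (V t)) has_real_derivative \<phi> (V t) * V' t) (at t within {a..b})"
      by (rule DERIV_chain2[OF \<Phi>[OF pos[OF t]] V[OF t]])
    have "\<phi> (V t) * V' t \<le> \<phi> (V t) * - d (V t)"
      using \<phi>(1) pos decay t by (intro mult_left_mono) auto
    then show "\<phi> (V t) * V' t \<le> - c" using \<phi>(2)[OF pos[OF t]] by simp
  qed
  then show ?thesis by simp
qed

lemma powr_antiderivative:
  fixes v \<alpha> :: real
  assumes "v > 0" "\<alpha> \<noteq> 1"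
  shows "((\<lambda>v. v powr (1 - \<alpha>) / (1 - \<alpha>)) has_real_derivative v powr (- \<alpha>)) (at v)"
  using assms by (auto intro!: derivative_eq_intros)

text \<open>The time spent above level 1 is at most \<open>1 / (p2 (\<alpha>2 - 1))\<close> by the superlinear term alone,
  the time spent below it less than \<open>1 / (p1 (1 - \<alpha>1))\<close> by the sublinear one.\<close>

lemma fixed_time_bound:
  fixes V :: "real \<Rightarrow> real"
  assumes p: "p1 > 0" "p2 > 0" and \<alpha>: "\<alpha>1 < 1" "1 < \<alpha>2" and s: "s \<ge> 0"
    and V: "\<And>t. t \<in> {0..s} \<Longrightarrow> (V has_real_derivative V' t) (at t within {0..s})"
    and pos: "\<And>t. t \<in> {0..s} \<Longrightarrow> V t > 0"
    and decay: "\<And>t. t \<in> {0..s} \<Longrightarrow> V' t \<le> - (p1 * V t powr \<alpha>1 + p2 * V t powr \<alpha>2)"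
  shows "s < 1 / (p1 * (1 - \<alpha>1)) + 1 / (p2 * (\<alpha>2 - 1))"
proof -
  define t0 where "t0 = 1 / (p2 * (\<alpha>2 - 1))"
  have t0: "t0 \<ge> 0" and first: "1 / (p1 * (1 - \<alpha>1)) > 0" using p \<alpha> by (auto simp: t0_def)
  show ?thesis
  proof (cases "s < t0")
    case True
    then show ?thesis using first unfolding t0_def by linarith
  next
    case False
    have sub: "(V has_real_derivative V' t) (at t within {a..b})" if "t \<in> {a..b}" "{a..b} \<subseteq> {0..s}" for t a b
      using V that by (meson DERIV_subset subsetD)
    have "V t0 powr (1 - \<alpha>2) / (1 - \<alpha>2) \<le> V 0 powr (1 - \<alpha>2) / (1 - \<alpha>2) - p2 * (t0 - 0)"
    proof (rule scalar_comparison[where V = V and V' = V' and \<Phi> = "\<lambda>v. v powr (1 - \<alpha>2) / (1 - \<alpha>2)"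
            and \<phi> = "\<lambda>v. v powr (- \<alpha>2)" and d = "\<lambda>v. p1 * v powr \<alpha>1 + p2 * v powr \<alpha>2"])
      show "p2 \<le> v powr - \<alpha>2 * (p1 * v powr \<alpha>1 + p2 * v powr \<alpha>2)" if "v > 0" for v
        using that p by (simp add: powr_minus field_simps)
    qed (use False t0 \<alpha> sub pos decay powr_antiderivative[of _ \<alpha>2] in auto)
    \<comment> \<open>The contribution of \<open>V 0\<close> is nonpositive whatever its size; this
      makes the time bound independent of the initial value.\<close>
    also have "\<dots> \<le> - 1 / (\<alpha>2 - 1)"
    proof -
      have "V 0 powr (1 - \<alpha>2) / (1 - \<alpha>2) \<le> 0"
        using \<alpha> by (intro divide_nonneg_neg) auto
      then show ?thesis using p \<alpha> by (simp add: t0_def)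
    qed
    also have "\<dots> = 1 / (1 - \<alpha>2)" using \<alpha> by (simp add: field_simps)
    finally have "V t0 powr (1 - \<alpha>2) \<ge> 1" using \<alpha> by (simp add: divide_le_cancel)
    then have V1: "V t0 \<le> 1"
      using \<alpha> powr_less_mono2_neg[of "1 - \<alpha>2" 1 "V t0"] by (cases "V t0 \<le> 1") auto
    have "V s powr (1 - \<alpha>1) / (1 - \<alpha>1) \<le> V t0 powr (1 - \<alpha>1) / (1 - \<alpha>1) - p1 * (s - t0)"
    proof (rule scalar_comparison[where V = V and V' = V' and \<Phi> = "\<lambda>v. v powr (1 - \<alpha>1) / (1 - \<alpha>1)"
            and \<phi> = "\<lambda>v. v powr (- \<alpha>1)" and d = "\<lambda>v. p1 * v powr \<alpha>1 + p2 * v powr \<alpha>2"])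
      show "p1 \<le> v powr - \<alpha>1 * (p1 * v powr \<alpha>1 + p2 * v powr \<alpha>2)" if "v > 0" for v
        using that p by (simp add: powr_minus field_simps)
    qed (use False t0 \<alpha> sub pos decay powr_antiderivative[of _ \<alpha>1] in auto)
    \<comment> \<open>\<open>V\<close> is still positive at \<open>s\<close>, so the bound comes out
      strict.\<close>
    moreover have "V s powr (1 - \<alpha>1) / (1 - \<alpha>1) > 0" using pos[of s] s \<alpha> by auto
    moreover have "V t0 powr (1 - \<alpha>1) / (1 - \<alpha>1) \<le> 1 / (1 - \<alpha>1)"
      using V1 \<alpha> pos[of t0] False t0 by (intro divide_right_mono powr_le1) auto
    ultimately have "p1 * (s - t0) < 1 / (1 - \<alpha>1)" by linarith
    then have "s - t0 < 1 / (p1 * (1 - \<alpha>1))" using p \<alpha> by (simp add: field_simps)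
    then show ?thesis by (simp add: t0_def)
  qed
qed

text \<open>With \<open>v = s\<^bsup>2 \<xi>\<^esup>\<close> the integral of \<open>1 / (p1 v\<^bsup>1 - 1/(2 \<xi>)\<^esup> + p2 v\<^bsup>1 + 1/(2 \<xi>)\<^esup>)\<close> becomes an arctangent.\<close>

lemma fixed_time_bound_arctan:
  fixes V :: "real \<Rightarrow> real"
  assumes p: "p1 > 0" "p2 > 0" and \<xi>: "\<xi> > 0" and s: "s \<ge> 0"
    and V: "\<And>t. t \<in> {0..s} \<Longrightarrow> (V has_real_derivative V' t) (at t within {0..s})"
    and pos: "\<And>t. t \<in> {0..s} \<Longrightarrow> V t > 0"
    and decay: "\<And>t. t \<in> {0..s} \<Longrightarrow>
      V' t \<le> - (p1 * V t powr (1 - 1 / (2 * \<xi>)) + p2 * V t powr (1 + 1 / (2 * \<xi>)))"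
  shows "s < pi * \<xi> / sqrt (p1 * p2)"
proof -
  define e where "e = 1 / (2 * \<xi>)"
  define r where "r = sqrt (p2 / p1)"
  \<comment> \<open>\<open>C\<close> is fixed by \<open>C * r * e = 1 / p1\<close>, which makes
    \<open>\<Phi>\<close> fall at rate at least 1. On positive arguments \<open>\<Phi>\<close> lies
    between 0 and \<open>C * (pi / 2)\<close>, which bounds the elapsed time.\<close>
  define C where "C = 2 * \<xi> / sqrt (p1 * p2)"
  define \<Phi> where "\<Phi> = (\<lambda>v. C * arctan (r * v powr e))"
  have e: "e > 0" and r: "r > 0" and C: "C > 0" using p \<xi> by (auto simp: e_def r_def C_def)
  have r2: "r\<^sup>2 = p2 / p1" using p by (simp add: r_def)
  have "(p1 * r)\<^sup>2 = p1 * p2"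
    unfolding power_mult_distrib r2 using p by (simp add: power2_eq_square)
  then have "sqrt (p1 * p2) = p1 * r" using p r by (intro real_sqrt_unique) auto
  then have CreK: "C * r * e = 1 / p1" using r p \<xi> by (simp add: C_def e_def)
  have "\<Phi> (V s) \<le> \<Phi> (V 0) - 1 * (s - 0)"
  proof (rule scalar_comparison[where V = V and V' = V' and \<Phi> = \<Phi>
        and \<phi> = "\<lambda>v. C * (inverse (1 + (r * v powr e)\<^sup>2) * (r * (e * v powr (e - 1))))"
        and d = "\<lambda>v. p1 * v powr (1 - e) + p2 * v powr (1 + e)"])
    fix v :: real assume v: "v > 0"
    show "(\<Phi> has_real_derivative C * (inverse (1 + (r * v powr e)\<^sup>2) * (r * (e * v powr (e - 1))))) (at v)"
      unfolding \<Phi>_def using v by (auto intro!: derivative_eq_intros)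
    show "0 \<le> C * (inverse (1 + (r * v powr e)\<^sup>2) * (r * (e * v powr (e - 1))))"
      using C r e by simp
    define w where "w = v powr e"
    have w: "w > 0" using v by (simp add: w_def)
    have D: "p1 + p2 * w\<^sup>2 > 0" using p by (intro add_pos_nonneg) auto
    have "C * (inverse (1 + (r * v powr e)\<^sup>2) * (r * (e * v powr (e - 1))))
        = (C * r * e) * (w / v) / (1 + r\<^sup>2 * w\<^sup>2)"
      using v by (simp add: w_def powr_diff power_mult_distrib divide_inverse)
    also have "\<dots> = w / (v * (p1 + p2 * w\<^sup>2))"
      unfolding CreK r2 using p v D by (simp add: field_simps)
    finally have "C * (inverse (1 + (r * v powr e)\<^sup>2) * (r * (e * v powr (e - 1))))
        = w / (v * (p1 + p2 * w\<^sup>2))" .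
    moreover have "p1 * v powr (1 - e) + p2 * v powr (1 + e) = v * (p1 + p2 * w\<^sup>2) / w"
      using v w by (simp add: powr_diff powr_add w_def[symmetric] field_simps power2_eq_square)
    ultimately show "1 \<le> C * (inverse (1 + (r * v powr e)\<^sup>2) * (r * (e * v powr (e - 1)))) *
        (p1 * v powr (1 - e) + p2 * v powr (1 + e))"
      using v w D by simp
  qed (use s V pos decay in \<open>auto simp: e_def\<close>)
  moreover have "\<Phi> (V s) > 0"
    using C r pos[of s] s by (simp add: \<Phi>_def)
  moreover have "\<Phi> (V 0) < C * (pi / 2)"
    unfolding \<Phi>_def using C arctan_ubound by (intro mult_strict_left_mono) auto
  ultimately have "s < C * (pi / 2)" by simp
  then show ?thesis by (simp add: C_def mult.commute)
qed

subsection \<open>The power-damped flow of a strongly monotone map\<close>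

text \<open>Scaling the field down where it is large keeps it dissipative,
  so the Peano solution never leaves the ball on which nothing was changed.\<close>

lemma dissipative_solution_exists:
  fixes G :: "'a::euclidean_space \<Rightarrow> 'a"
  assumes cont: "continuous_on UNIV G" and diss: "\<And>x. inner (x - p) (G x) \<le> 0"
  obtains x where "x 0 = x0"
    and "\<And>t. t \<in> {0..T} \<Longrightarrow> (x has_vector_derivative G (x t)) (at t within {0..T})"
proof -
  define R where "R = norm (x0 - p)"
  have "bounded (G ` cball p R)"
    by (intro compact_imp_bounded compact_continuous_image continuous_on_subset[OF cont]) auto
  then obtain M where M: "M > 0" "\<And>y. y \<in> cball p R \<Longrightarrow> norm (G y) \<le> M"
    by (auto simp: bounded_pos)
  \<comment> \<open>The factor is positive and continuous in \<open>y\<close>, and it equals 1 where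
    \<open>norm (G y) \<le> M\<close>, in particular on \<open>cball p R\<close>.\<close>
  define g where "g = (\<lambda>y. (M / max M (norm (G y))) *\<^sub>R G y)"
  have "continuous_on UNIV g"
    unfolding g_def using M(1) by (intro continuous_intros cont) auto
  moreover have "norm (g y) \<le> M" for y
    using M(1) by (auto simp: g_def field_simps max_def)
  ultimately obtain x where x: "x 0 = x0"
    "\<And>t. t \<in> {0..T} \<Longrightarrow> (x has_vector_derivative g (x t)) (at t within {0..T})"
    using peano_bounded by blast
  have "g (x t) = G (x t)" if t: "t \<in> {0..T}" for t
  proof -
    have "(norm (x t - p))\<^sup>2 / 2 - (norm (x 0 - p))\<^sup>2 / 2 \<le> 0 * (t - 0)"
    proof (rule increment_le_of_derivative_le)
      fix s assume s: "s \<in> {0..t}"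
      show "((\<lambda>t. (norm (x t - p))\<^sup>2 / 2) has_real_derivative inner (x s - p) (g (x s))) (at s within {0..t})"
        using x(2)[of s] s t
        by (intro half_sq_norm_has_derivative) (auto elim!: has_vector_derivative_within_subset)
      show "inner (x s - p) (g (x s)) \<le> 0"
        unfolding g_def inner_scaleR_right using M(1) by (intro mult_nonneg_nonpos diss) auto
    qed (use t in auto)
    then have "(norm (x t - p))\<^sup>2 \<le> (norm (x 0 - p))\<^sup>2" by simp
    then have "norm (x t - p) \<le> R"
      unfolding R_def x(1)[symmetric] by (rule power2_le_imp_le) simp
    then have "norm (G (x t)) \<le> M" by (intro M(2)) (simp add: dist_norm norm_minus_commute)
    then show ?thesis using M(1) by (simp add: g_def)
  qed
  with x that show ?thesis by metis
qed

text \<open>Abstracts the residual \<open>Id - S\<close> of a contraction \<open>S\<close>: for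
  contraction constant \<open>q\<close> the instance has \<open>m = 1 - q\<close> and
  \<open>K = 2\<close>.\<close>

locale power_damped_flow =
  fixes F :: "'a::euclidean_space \<Rightarrow> 'a" and xs :: 'a and m K c1 c2 \<kappa>1 \<kappa>2 :: real
  assumes strongly_monotone: "\<And>x y. m * (norm (x - y))\<^sup>2 \<le> inner (x - y) (F x - F y)"
    and lipschitz: "\<And>x y. norm (F x - F y) \<le> K * norm (x - y)"
    and zero: "F xs = 0"
    and m_pos: "m > 0" and K_pos: "K > 0" and c_pos: "c1 > 0" "c2 > 0"
    and \<kappa>: "0 < \<kappa>1" "\<kappa>1 < 1" "1 < \<kappa>2"
begin

definition gain :: "real \<Rightarrow> real" where
  "gain r = c1 * r powr (\<kappa>1 - 1) + c2 * r powr (\<kappa>2 - 1)"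

definition G :: "'a \<Rightarrow> 'a" where
  "G x = - gain (norm (F x)) *\<^sub>R F x"

text \<open>The coefficients of the decay estimate for \<open>V\<close>: \<open>K\<close> enters
  where the residual norm has a negative exponent, \<open>m\<close> where it has a positive one, and
  the powers of 2 undo the half in \<open>V\<close>.\<close>

definition p1 :: real where "p1 = c1 * m * K powr (\<kappa>1 - 1) * 2 powr ((1 + \<kappa>1) / 2)"
definition p2 :: real where "p2 = c2 * m * m powr (\<kappa>2 - 1) * 2 powr ((1 + \<kappa>2) / 2)"

section \<open>Estimates and continuity of the damped field\<close>

lemma p_pos: "p1 > 0" "p2 > 0"
  using c_pos m_pos K_pos by (auto simp: p1_def p2_def)

lemma norm_F_upper: "norm (F x) \<le> K * norm (x - xs)"
  using lipschitz[of x xs] by (simp add: zero)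

lemma inner_F_lower: "m * (norm (x - xs))\<^sup>2 \<le> inner (x - xs) (F x)"
  using strongly_monotone[of x xs] by (simp add: zero)

lemma norm_F_lower: "m * norm (x - xs) \<le> norm (F x)"
proof -
  have "norm (x - xs) * (m * norm (x - xs)) \<le> norm (x - xs) * norm (F x)"
    using inner_F_lower[of x] norm_cauchy_schwarz[of "x - xs" "F x"]
    by (simp add: power2_eq_square mult_ac)
  then show ?thesis by (cases "x = xs") auto
qed

lemma F_eq_0_iff: "F x = 0 \<longleftrightarrow> x = xs"
proof
  assume "F x = 0"
  then have "m * norm (x - xs) \<le> 0" using norm_F_lower[of x] by simp
  then show "x = xs" using m_pos by (simp add: mult_le_0_iff)
qed (simp add: zero)

lemma G_xs [simp]: "G xs = 0"
  by (simp add: G_def zero)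

lemma continuous_on_F: "continuous_on S F"
proof -
  have "K-lipschitz_on S F"
    using K_pos lipschitz by (auto simp: lipschitz_on_def dist_norm)
  then show ?thesis by (rule lipschitz_on_continuous_on)
qed

lemma norm_G: "norm (G x) = c1 * norm (F x) powr \<kappa>1 + c2 * norm (F x) powr \<kappa>2"
proof (cases "F x = 0")
  case False
  have "gain (norm (F x)) \<ge> 0" using c_pos by (simp add: gain_def)
  then have "norm (G x) = gain (norm (F x)) * norm (F x)" by (simp add: G_def)
  also have "\<dots> = c1 * norm (F x) powr \<kappa>1 + c2 * norm (F x) powr \<kappa>2"
    using False by (simp add: gain_def powr_diff field_simps)
  finally show ?thesis .
qed (simp add: G_def)

text \<open>\<open>gain\<close> blows up near residual zero, but by \<open>norm_G\<close> the field
  itself carries only positive powers of the residual norm, so it tends to 0 at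
  \<open>xs\<close>.\<close>

lemma continuous_on_G: "continuous_on UNIV G"
proof (rule continuous_at_imp_continuous_on, rule ballI)
  fix x
  have F: "isCont F x" using continuous_on_F[of UNIV] by (simp add: continuous_on_eq_continuous_at)
  show "isCont G x"
  proof (cases "x = xs")
    case False
    then have "F x \<noteq> 0" by (simp add: F_eq_0_iff)
    then show ?thesis
      unfolding G_def gain_def by (intro continuous_intros F) auto
  next
    case True
    have "((\<lambda>y. norm (F y)) \<longlongrightarrow> 0) (at xs)"
      using F True zero tendsto_norm[of F 0 "at xs"] by (simp add: isCont_def)
    then have "((\<lambda>y. norm (F y) powr k) \<longlongrightarrow> 0) (at xs)" if "k > 0" for k
      using that by (intro tendsto_zero_powrI[where b = k]) auto
    from this[of \<kappa>1] this[of \<kappa>2]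
    have "((\<lambda>y. c1 * norm (F y) powr \<kappa>1 + c2 * norm (F y) powr \<kappa>2) \<longlongrightarrow> c1 * 0 + c2 * 0) (at xs)"
      using \<kappa> by (intro tendsto_add tendsto_mult_left) auto
    then have "((\<lambda>y. norm (G y)) \<longlongrightarrow> 0) (at xs)" by (simp add: norm_G)
    then show ?thesis using True by (simp add: isCont_def tendsto_norm_zero_iff)
  qed
qed

text \<open>Strong monotonicity supplies the factor \<open>m * r\<^sup>2\<close>. The negative
  exponent \<open>\<kappa>1 - 1\<close> then calls for the upper bound \<open>n \<le> K * r\<close>,
  the positive exponent \<open>\<kappa>2 - 1\<close> for the lower bound
  \<open>m * r \<le> n\<close>.\<close>

lemma decay:
  assumes "x \<noteq> xs"
  defines "V \<equiv> (norm (x - xs))\<^sup>2 / 2"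
  shows "inner (x - xs) (G x) \<le> - (p1 * V powr ((1 + \<kappa>1) / 2) + p2 * V powr ((1 + \<kappa>2) / 2))"
proof -
  define r where "r = norm (x - xs)"
  define n where "n = norm (F x)"
  have r: "r > 0" using assms by (simp add: r_def)
  have n: "n > 0" "n \<le> K * r" "m * r \<le> n"
    using assms norm_F_upper norm_F_lower by (auto simp: n_def r_def F_eq_0_iff)
  have Vp: "2 powr ((1 + k) / 2) * V powr ((1 + k) / 2) = r powr (k - 1) * r\<^sup>2" for k
  proof -
    have "2 powr ((1 + k) / 2) * V powr ((1 + k) / 2) = (r\<^sup>2) powr ((1 + k) / 2)"
      by (simp add: V_def r_def flip: powr_mult)
    also have "\<dots> = r powr (1 + k)" using r by (simp add: powr_powr add_divide_distrib flip: powr_numeral)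
    also have "\<dots> = r powr (k - 1) * r\<^sup>2" using r by (simp add: algebra_simps flip: powr_numeral powr_add)
    finally show ?thesis .
  qed
  have "p1 * V powr ((1 + \<kappa>1) / 2) = c1 * (K * r) powr (\<kappa>1 - 1) * (m * r\<^sup>2)"
    using Vp[of \<kappa>1] r K_pos by (simp add: p1_def powr_mult mult_ac)
  also have "\<dots> \<le> c1 * n powr (\<kappa>1 - 1) * (m * r\<^sup>2)"
    using n \<kappa> c_pos m_pos by (intro mult_right_mono mult_left_mono powr_mono2') auto
  finally have 1: "p1 * V powr ((1 + \<kappa>1) / 2) \<le> c1 * n powr (\<kappa>1 - 1) * (m * r\<^sup>2)" .
  have "p2 * V powr ((1 + \<kappa>2) / 2) = c2 * (m * r) powr (\<kappa>2 - 1) * (m * r\<^sup>2)"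
    using Vp[of \<kappa>2] r m_pos by (simp add: p2_def powr_mult mult_ac)
  also have "\<dots> \<le> c2 * n powr (\<kappa>2 - 1) * (m * r\<^sup>2)"
    using n \<kappa> c_pos m_pos r by (intro mult_right_mono mult_left_mono powr_mono2) auto
  finally have 2: "p2 * V powr ((1 + \<kappa>2) / 2) \<le> c2 * n powr (\<kappa>2 - 1) * (m * r\<^sup>2)" .
  have "gain n * (m * r\<^sup>2) \<le> gain n * inner (x - xs) (F x)"
    using inner_F_lower[of x] c_pos by (intro mult_left_mono) (auto simp: gain_def r_def)
  moreover have "inner (x - xs) (G x) = - (gain n * inner (x - xs) (F x))"
    by (simp add: G_def n_def)
  moreover have "gain n * (m * r\<^sup>2) = c1 * n powr (\<kappa>1 - 1) * (m * r\<^sup>2) + c2 * n powr (\<kappa>2 - 1) * (m * r\<^sup>2)"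
    by (simp add: gain_def distrib_right)
  ultimately show ?thesis using 1 2 by linarith
qed

lemma dissipative: "inner (x - xs) (G x) \<le> 0"
proof (cases "x = xs")
  case False
  have "0 \<le> p1 * ((norm (x - xs))\<^sup>2 / 2) powr ((1 + \<kappa>1) / 2)
      + p2 * ((norm (x - xs))\<^sup>2 / 2) powr ((1 + \<kappa>2) / 2)"
    using p_pos by (intro add_nonneg_nonneg mult_nonneg_nonneg) auto
  then show ?thesis using decay[OF False] by linarith
qed simp

section \<open>Monotone distance and uniqueness away from the equilibrium\<close>

lemma norm_nonincreasing:
  assumes "a \<le> b"
    and "\<And>t. t \<in> {a..b} \<Longrightarrow> (x has_vector_derivative G (x t)) (at t within {a..b})"
  shows "norm (x b - xs) \<le> norm (x a - xs)"
proof -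
  have "(norm (x b - xs))\<^sup>2 / 2 - (norm (x a - xs))\<^sup>2 / 2 \<le> 0 * (b - a)"
    by (rule increment_le_of_derivative_le[OF assms(1) half_sq_norm_has_derivative[OF assms(2)]])
      (use dissipative in auto)
  then show ?thesis by (auto intro: power2_le_imp_le)
qed

text \<open>On the annulus the residual norm stays in the compact interval \<open>I\<close> of
  positive numbers, where \<open>gain\<close> and its derivative are bounded. So \<open>G\<close> is
  a product of bounded Lipschitz functions.\<close>

lemma lipschitz_on_annulus:
  assumes "r > 0"
  obtains C where "\<And>u v. r \<le> norm (u - xs) \<Longrightarrow> norm (u - xs) \<le> R \<Longrightarrow>
      r \<le> norm (v - xs) \<Longrightarrow> norm (v - xs) \<le> R \<Longrightarrow> norm (G u - G v) \<le> C * norm (u - v)"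
proof -
  define I where "I = {m * r..K * R}"
  have I: "a > 0" if "a \<in> I" for a
    using that mult_pos_pos[OF m_pos assms] by (auto simp: I_def)
  define gain' where "gain' = (\<lambda>a. c1 * ((\<kappa>1 - 1) * a powr (\<kappa>1 - 2)) + c2 * ((\<kappa>2 - 1) * a powr (\<kappa>2 - 2)))"
  have deriv: "(gain has_real_derivative gain' a) (at a within I)" if "a \<in> I" for a
    unfolding gain_def[abs_def] gain'_def using I[OF that]
    by (auto intro!: derivative_eq_intros)
  have "continuous_on I gain'" unfolding gain'_def
    using I by (intro continuous_intros) force+
  then have "bounded (gain' ` I)"
    by (intro compact_imp_bounded compact_continuous_image) (auto simp: I_def)
  then obtain D where D: "\<And>a. a \<in> I \<Longrightarrow> \<bar>gain' a\<bar> \<le> D" by (auto simp: bounded_iff)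
  have "continuous_on I gain"
    using deriv by (intro DERIV_continuous_on)
  then have "bounded (gain ` I)"
    by (intro compact_imp_bounded compact_continuous_image) (auto simp: I_def)
  then obtain H where H: "\<And>a. a \<in> I \<Longrightarrow> \<bar>gain a\<bar> \<le> H" by (auto simp: bounded_iff)
  have lip: "\<bar>gain a - gain b\<bar> \<le> D * \<bar>a - b\<bar>" if "a \<in> I" "b \<in> I" for a b
    using field_differentiable_bound[of I gain gain' D a b] deriv D that by (auto simp: I_def)
  show ?thesis
  \<comment> \<open>\<open>H * K\<close> pays for the change of \<open>F\<close>; the other term
    pays for the change of \<open>gain\<close>, multiplied by
    \<open>norm (F v) \<le> K * R\<close>.\<close>
  proof (rule that[of "H * K + D * K * (K * R)"])
    fix u v
    assume u: "r \<le> norm (u - xs)" "norm (u - xs) \<le> R" and v: "r \<le> norm (v - xs)" "norm (v - xs) \<le> R"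
    have in_I: "norm (F y) \<in> I" if "r \<le> norm (y - xs)" "norm (y - xs) \<le> R" for y
    proof -
      have "m * r \<le> m * norm (y - xs)" "K * norm (y - xs) \<le> K * R"
        using that m_pos K_pos by (auto intro: mult_left_mono)
      then show ?thesis using norm_F_lower[of y] norm_F_upper[of y] by (simp add: I_def)
    qed
    have "G u - G v = - (gain (norm (F u)) *\<^sub>R (F u - F v)) - (gain (norm (F u)) - gain (norm (F v))) *\<^sub>R F v"
      by (simp add: G_def algebra_simps)
    then have "norm (G u - G v) \<le> norm (- (gain (norm (F u)) *\<^sub>R (F u - F v)))
        + norm ((gain (norm (F u)) - gain (norm (F v))) *\<^sub>R F v)"
      by (metis norm_triangle_ineq4)
    also have "\<dots> = \<bar>gain (norm (F u))\<bar> * norm (F u - F v)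
        + \<bar>gain (norm (F u)) - gain (norm (F v))\<bar> * norm (F v)"
      by (simp only: norm_minus_cancel norm_scaleR)
    also have "\<dots> \<le> H * (K * norm (u - v)) + D * (K * norm (u - v)) * (K * R)"
    proof (intro add_mono mult_mono)
      show "\<bar>gain (norm (F u))\<bar> \<le> H" using H in_I u by blast
      then show "0 \<le> H" by simp
      show "norm (F u - F v) \<le> K * norm (u - v)" by (rule lipschitz)
      have D0: "D \<ge> 0" using D[OF in_I[OF u]] by simp
      have "\<bar>gain (norm (F u)) - gain (norm (F v))\<bar> \<le> D * \<bar>norm (F u) - norm (F v)\<bar>"
        using lip in_I u v by blast
      also have "\<dots> \<le> D * (K * norm (u - v))"
        using D0 lipschitz[of u v] norm_triangle_ineq3[of "F u" "F v"] by (intro mult_left_mono) auto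
      finally show "\<bar>gain (norm (F u)) - gain (norm (F v))\<bar> \<le> D * (K * norm (u - v))" .
      show "norm (F v) \<le> K * R" using in_I v by (simp add: I_def)
      show "0 \<le> D * (K * norm (u - v))" using D0 K_pos by simp
    qed auto
    finally show "norm (G u - G v) \<le> (H * K + D * K * (K * R)) * norm (u - v)"
      by (simp add: algebra_simps)
  qed
qed

text \<open>Distances to \<open>xs\<close> never increase, so both trajectories lie in the annulus
  between the smaller final distance and the common initial one. There \<open>G\<close> is Lipschitz
  and Gronwall's argument applies.\<close>

lemma unique_away_from_equilibrium:
  assumes "s \<ge> 0" "x 0 = y 0" "x s \<noteq> xs" "y s \<noteq> xs"
    and x: "\<And>t. t \<in> {0..s} \<Longrightarrow> (x has_vector_derivative G (x t)) (at t within {0..s})"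
    and y: "\<And>t. t \<in> {0..s} \<Longrightarrow> (y has_vector_derivative G (y t)) (at t within {0..s})"
  shows "x s = y s"
proof -
  define r where "r = min (norm (x s - xs)) (norm (y s - xs))"
  define R where "R = norm (x 0 - xs)"
  have "r > 0" using assms by (simp add: r_def)
  then obtain C where C: "\<And>u v. r \<le> norm (u - xs) \<Longrightarrow> norm (u - xs) \<le> R \<Longrightarrow>
      r \<le> norm (v - xs) \<Longrightarrow> norm (v - xs) \<le> R \<Longrightarrow> norm (G u - G v) \<le> C * norm (u - v)"
    using lipschitz_on_annulus by blast
  have ann: "norm (z s - xs) \<le> norm (z t - xs)" "norm (z t - xs) \<le> norm (z 0 - xs)"
    if t: "t \<in> {0..s}"
      and z: "\<And>t. t \<in> {0..s} \<Longrightarrow> (z has_vector_derivative G (z t)) (at t within {0..s})" for z t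
  proof -
    show "norm (z s - xs) \<le> norm (z t - xs)"
      using t by (intro norm_nonincreasing has_vector_derivative_within_subset[OF z]) auto
    show "norm (z t - xs) \<le> norm (z 0 - xs)"
      using t by (intro norm_nonincreasing has_vector_derivative_within_subset[OF z]) auto
  qed
  \<comment> \<open>The weight absorbs the growth rate \<open>2 * C\<close> of the squared distance,
    so \<open>E\<close> cannot increase from \<open>E 0 = 0\<close>.\<close>
  define E where "E = (\<lambda>t. exp (- 2 * C * t) * ((norm ((x t - y t) - 0))\<^sup>2 / 2))"
  have "E s - E 0 \<le> 0 * (s - 0)"
  proof (rule increment_le_of_derivative_le[OF assms(1)])
    fix t assume t: "t \<in> {0..s}"
    let ?D = "inner (x t - y t) (G (x t) - G (y t))"
    have sq: "((\<lambda>t. (norm ((x t - y t) - 0))\<^sup>2 / 2) has_real_derivative inner ((x t - y t) - 0) (G (x t) - G (y t)))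
        (at t within {0..s})"
      using x[OF t] y[OF t]
      by (intro half_sq_norm_has_derivative has_vector_derivative_diff)
    have "((\<lambda>t. exp (- 2 * C * t)) has_real_derivative - 2 * C * exp (- 2 * C * t)) (at t within {0..s})"
      by (auto intro!: derivative_eq_intros)
    from DERIV_mult[OF this sq]
    show "(E has_real_derivative exp (- 2 * C * t) * (?D - C * (norm (x t - y t))\<^sup>2)) (at t within {0..s})"
      unfolding E_def by (rule DERIV_cong) (simp add: algebra_simps)
    have "?D \<le> norm (x t - y t) * norm (G (x t) - G (y t))" by (rule norm_cauchy_schwarz)
    also have "\<dots> \<le> norm (x t - y t) * (C * norm (x t - y t))"
      using ann[OF t x] ann[OF t y] assms(2) by (intro mult_left_mono C) (auto simp: r_def R_def)
    finally show "exp (- 2 * C * t) * (?D - C * (norm (x t - y t))\<^sup>2) \<le> 0"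
      by (simp add: mult_le_0_iff power2_eq_square mult_ac)
  qed
  then have "E s \<le> 0" using assms(2) by (simp add: E_def)
  then show ?thesis by (simp add: E_def mult_le_0_iff)
qed

text \<open>While \<open>xs\<close> is avoided, half the squared distance is positive and the scalar
  estimates apply. Strictness matters: at \<open>s\<close> equal to the first bound it is
  contradictory, so \<open>xs\<close> has been reached by then.\<close>

lemma avoidance_time_bounds:
  assumes "s \<ge> 0"
    and x: "\<And>t. t \<in> {0..s} \<Longrightarrow> (x has_vector_derivative G (x t)) (at t within {0..s})"
    and ne: "\<And>t. t \<in> {0..s} \<Longrightarrow> x t \<noteq> xs"
  shows "s < 1 / (p1 * (1 - (1 + \<kappa>1) / 2)) + 1 / (p2 * ((1 + \<kappa>2) / 2 - 1))"
    and "\<xi> > 0 \<Longrightarrow> (1 + \<kappa>1) / 2 = 1 - 1 / (2 * \<xi>) \<Longrightarrow> (1 + \<kappa>2) / 2 = 1 + 1 / (2 * \<xi>) \<Longrightarrow>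
      s < pi * \<xi> / sqrt (p1 * p2)"
proof -
  define V where "V = (\<lambda>t. (norm (x t - xs))\<^sup>2 / 2)"
  have V: "(V has_real_derivative inner (x t - xs) (G (x t))) (at t within {0..s})"
    "V t > 0"
    "inner (x t - xs) (G (x t)) \<le> - (p1 * V t powr ((1 + \<kappa>1) / 2) + p2 * V t powr ((1 + \<kappa>2) / 2))"
    if "t \<in> {0..s}" for t
    using half_sq_norm_has_derivative[OF x[OF that]] ne[OF that] decay[OF ne[OF that]]
    by (auto simp: V_def)
  show "s < 1 / (p1 * (1 - (1 + \<kappa>1) / 2)) + 1 / (p2 * ((1 + \<kappa>2) / 2 - 1))"
    using p_pos \<kappa> assms(1) V by (intro fixed_time_bound[where V = V and V' = "\<lambda>t. inner (x t - xs) (G (x t))"]) auto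
  show "s < pi * \<xi> / sqrt (p1 * p2)"
    if "\<xi> > 0" "(1 + \<kappa>1) / 2 = 1 - 1 / (2 * \<xi>)" "(1 + \<kappa>2) / 2 = 1 + 1 / (2 * \<xi>)"
    using p_pos assms(1) V that(1) unfolding that(2,3) by (intro fixed_time_bound_arctan[where V = V and V' = "\<lambda>t. inner (x t - xs) (G (x t))"]) auto
qed

section \<open>Global existence of solutions\<close>

definition Tmax :: real where
  "Tmax = 1 / (p1 * (1 - (1 + \<kappa>1) / 2)) + 1 / (p2 * ((1 + \<kappa>2) / 2 - 1))"

lemma Tmax_pos: "Tmax > 0"
  unfolding Tmax_def using p_pos \<kappa> by (intro add_pos_pos) auto

lemma ode_solution_within:
  assumes "ode_solution G x0 x" "S \<subseteq> {0..}" "t \<in> S"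
  shows "(x has_vector_derivative G (x t)) (at t within S)"
  using assms by (auto simp: ode_solution_def elim!: has_vector_derivative_within_subset)

lemma ode_solution_norm_le:
  assumes "ode_solution G x0 x" "0 \<le> a" "a \<le> b"
  shows "norm (x b - xs) \<le> norm (x a - xs)"
  using assms by (intro norm_nonincreasing ode_solution_within) auto

text \<open>A solution on a bounded interval reaches \<open>xs\<close> by \<open>Tmax\<close> and
  rests there; the constant \<open>xs\<close> continues it to all later times.\<close>

lemma ode_solution_exists: "\<exists>x. ode_solution G x0 x"
proof -
  \<comment> \<open>The extra unit leaves an interval on which the solution already rests at
    \<open>xs\<close>, so the glued path is differentiable at \<open>T\<close>.\<close>
  define T where "T = Tmax + 1"
  obtain x where x: "x 0 = x0"
    "\<And>t. t \<in> {0..T} \<Longrightarrow> (x has_vector_derivative G (x t)) (at t within {0..T})"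
    using dissipative_solution_exists[OF continuous_on_G dissipative] by blast
  have T: "0 < Tmax" "Tmax < T" using Tmax_pos by (auto simp: T_def)
  obtain \<tau> where \<tau>: "0 \<le> \<tau>" "\<tau> \<le> Tmax" "x \<tau> = xs"
  proof -
    have "\<not> (\<forall>t\<in>{0..Tmax}. x t \<noteq> xs)"
    proof
      assume "\<forall>t\<in>{0..Tmax}. x t \<noteq> xs"
      then have "Tmax < Tmax"
        using T by (intro avoidance_time_bounds(1)[where x = x, folded Tmax_def]
            has_vector_derivative_within_subset[OF x(2)]) auto
      then show False by simp
    qed
    then show ?thesis using that by auto
  qed
  have stay: "x t = xs" if "\<tau> \<le> t" "t \<le> T" for t
  proof -
    have "norm (x t - xs) \<le> norm (x \<tau> - xs)"
      using \<tau> that by (intro norm_nonincreasing has_vector_derivative_within_subset[OF x(2)]) auto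
    then show ?thesis using \<tau> by simp
  qed
  define z where "z = (\<lambda>t. if t < T then x t else xs)"
  have "(z has_vector_derivative G (z t)) (at t within {0..})" if t: "t \<ge> 0" for t
  proof (cases "t < T")
    case True
    have "(x has_vector_derivative G (x t)) (at t within {0..<T})"
      using x(2)[of t] t True by (auto elim!: has_vector_derivative_within_subset)
    also have "at t within {0..<T} = at t within {0..}"
      by (rule at_within_nhd[of t "{..<T}"]) (use True in auto)
    finally show ?thesis
      using True t
      by (intro has_vector_derivative_transform_within[where f = x and g = z and d = "T - t"])
        (auto simp: z_def dist_real_def)
  next
    case False
    have "z s = xs" if "\<tau> < s" for s using that stay by (auto simp: z_def)
    moreover have "((\<lambda>_. xs) has_vector_derivative 0) (at t within {0..})" by auto
    ultimately have "(z has_vector_derivative 0) (at t within {0..})"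
      using False T \<tau> t
      by (intro has_vector_derivative_transform_within[where f = "\<lambda>_. xs" and g = z and d = "t - \<tau>"])
        (auto simp: dist_real_def)
    then show ?thesis using False by (simp add: z_def)
  qed
  then have "ode_solution G x0 z" using x(1) T by (auto simp: ode_solution_def z_def)
  then show ?thesis by blast
qed

section \<open>First arrival and settling time\<close>

lemma ode_solution_continuous_on: "ode_solution G x0 x \<Longrightarrow> continuous_on {0..} x"
  using has_vector_derivative_continuous
  by (fastforce simp: ode_solution_def continuous_on_eq_continuous_within)

lemma ode_solution_first_hit:
  assumes "ode_solution G x0 x" "x0 \<noteq> xs" "0 \<le> s" "x s = xs"
  defines "\<sigma> \<equiv> Inf {t. 0 \<le> t \<and> x t = xs}"
  shows "0 < \<sigma>" "\<sigma> \<le> s" "x \<sigma> = xs" "\<And>t. 0 \<le> t \<Longrightarrow> t < \<sigma> \<Longrightarrow> x t \<noteq> xs"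
proof -
  let ?Z = "{t. 0 \<le> t \<and> x t = xs}"
  have bdd: "bdd_below ?Z" by (intro bdd_belowI[of _ 0]) auto
  \<comment> \<open>The set of arrival times is closed, so its infimum is attained.\<close>
  have "closed ({0..} \<inter> x -` {xs})"
    by (intro continuous_closed_preimage ode_solution_continuous_on[OF assms(1)]) auto
  moreover have "{0..} \<inter> x -` {xs} = ?Z" by auto
  ultimately have in_Z: "\<sigma> \<in> ?Z"
    unfolding \<sigma>_def using assms bdd by (intro closed_contains_Inf) auto
  have "x 0 \<noteq> xs" using assms by (simp add: ode_solution_def)
  then show "0 < \<sigma>" using in_Z by (auto simp: less_le)
  show "x \<sigma> = xs" using in_Z by simp
  show "\<sigma> \<le> s" unfolding \<sigma>_def using assms bdd by (intro cInf_lower) auto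
  show "x t \<noteq> xs" if "0 \<le> t" "t < \<sigma>" for t
    using cInf_lower[OF _ bdd, of t] that by (auto simp: \<sigma>_def)
qed

text \<open>If \<open>x\<close> missed \<open>xs\<close> at \<open>s\<close>, monotone distance
  would keep it away from \<open>xs\<close> on all of \<open>[0, s]\<close>. It would then agree
  with \<open>y\<close> before the first arrival \<open>\<sigma>\<close> of \<open>y\<close>, and by
  continuity also at \<open>\<sigma>\<close>, a contradiction.\<close>

lemma ode_solution_same_zeros:
  assumes x: "ode_solution G x0 x" and y: "ode_solution G x0 y" and "x0 \<noteq> xs" "0 \<le> s" "y s = xs"
  shows "x s = xs"
proof (rule ccontr)
  assume ne: "x s \<noteq> xs"
  define \<sigma> where "\<sigma> = Inf {t. 0 \<le> t \<and> y t = xs}"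
  note \<sigma> = ode_solution_first_hit[OF y assms(3-5), folded \<sigma>_def]
  have xne: "x t \<noteq> xs" if "0 \<le> t" "t \<le> s" for t
    using ode_solution_norm_le[OF x that] ne by auto
  have eq: "x t - y t = 0" if "t \<in> {0..<\<sigma>}" for t
  proof -
    have "x t = y t"
    proof (rule unique_away_from_equilibrium)
      show "x 0 = y 0" using x y by (simp add: ode_solution_def)
      show "x t \<noteq> xs" "y t \<noteq> xs" using xne \<sigma> that by auto
    qed (use that in \<open>auto intro!: ode_solution_within[OF x] ode_solution_within[OF y]\<close>)
    then show ?thesis by simp
  qed
  have cl: "closure {0..<\<sigma>} = {0..\<sigma>}" using \<sigma>(1) by simp
  have "x \<sigma> - y \<sigma> = 0"
  proof (rule continuous_constant_on_closure[of "{0..<\<sigma>}" "\<lambda>t. x t - y t"])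
    show "continuous_on (closure {0..<\<sigma>}) (\<lambda>t. x t - y t)"
      unfolding cl
      by (intro continuous_intros continuous_on_subset[OF ode_solution_continuous_on[OF x]]
          continuous_on_subset[OF ode_solution_continuous_on[OF y]]) auto
  qed (use eq \<sigma>(1) cl in auto)
  then show False using \<sigma> xne[of \<sigma>] by simp
qed

lemma ode_solution_hits:
  assumes "ode_solution G x0 x"
  obtains s where "0 \<le> s" "s \<le> Tmax" "x s = xs"
proof -
  have "\<not> (\<forall>t\<in>{0..Tmax}. x t \<noteq> xs)"
  proof
    assume "\<forall>t\<in>{0..Tmax}. x t \<noteq> xs"
    then have "Tmax < Tmax"
      using Tmax_pos by (intro avoidance_time_bounds(1)[where x = x, folded Tmax_def]
          ode_solution_within[OF assms]) auto
    then show False by simp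
  qed
  then show ?thesis using that by auto
qed

lemma lyapunov_stable_G: "lyapunov_stable G xs"
  unfolding lyapunov_stable_def
proof (intro allI impI)
  fix \<epsilon> :: real assume e: "\<epsilon> > 0"
  have "x t \<in> ball xs \<epsilon>" if "x0 \<in> ball xs \<epsilon>" "ode_solution G x0 x" "t > 0" for x0 x t
    using ode_solution_norm_le[OF that(2), of 0 t] that
    by (auto simp: ode_solution_def dist_norm norm_minus_commute)
  then show "\<exists>r>0. \<forall>x0\<in>ball xs r. (\<exists>x. ode_solution G x0 x) \<and>
      (\<forall>x. ode_solution G x0 x \<longrightarrow> (\<forall>t>0. x t \<in> ball xs \<epsilon>))"
    using e ode_solution_exists by blast
qed

text \<open>The first arrival of one chosen solution serves for all of them, because solutions from
  the same initial point are at \<open>xs\<close> at the same times.\<close>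

lemma settling_time_exists:
  obtains T where "settling_time G xs UNIV T" "\<And>x0. x0 \<noteq> xs \<Longrightarrow> T x0 \<le> Tmax"
proof -
  define X where "X = (\<lambda>x0. SOME x. ode_solution G x0 x)"
  have X: "ode_solution G x0 (X x0)" for x0
    unfolding X_def by (rule someI_ex[OF ode_solution_exists])
  define T where "T = (\<lambda>x0. Inf {t. 0 \<le> t \<and> X x0 t = xs})"
  have hit: "0 < T x0 \<and> T x0 \<le> Tmax \<and> x (T x0) = xs \<and> (\<forall>t\<in>{0..<T x0}. x t \<noteq> xs)"
    if x0: "x0 \<noteq> xs" and x: "ode_solution G x0 x" for x0 x
  proof -
    obtain s where s: "0 \<le> s" "s \<le> Tmax" "x s = xs" using ode_solution_hits[OF x] .
    have "{t. 0 \<le> t \<and> X x0 t = xs} = {t. 0 \<le> t \<and> x t = xs}"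
      using ode_solution_same_zeros[OF X x x0] ode_solution_same_zeros[OF x X x0] by blast
    then show ?thesis
      using ode_solution_first_hit[OF x x0 s(1,3)] s(2) by (auto simp: T_def)
  qed
  have "settling_time G xs UNIV T"
    unfolding settling_time_def
  proof (intro ballI conjI allI impI)
    fix x0 assume "x0 \<in> UNIV - {xs}"
    then have x0: "x0 \<noteq> xs" by simp
    show "T x0 > 0" using hit[OF x0 X] by blast
    show "\<exists>x. ode_solution G x0 x" by (rule ode_solution_exists)
    fix x assume x: "ode_solution G x0 x"
    note h = hit[OF x0 x]
    show "x t \<in> UNIV - {xs}" if "t \<in> {0..<T x0}" for t using h that by auto
    \<comment> \<open>\<open>0 < T x0\<close> makes this an interior point of the half-line, so
      continuity is two-sided there.\<close>
    have "isCont x (T x0)"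
      using ode_solution_continuous_on[OF x] h
      by (intro continuous_on_interior[of "{0..}"]) auto
    then show "(x \<longlongrightarrow> xs) (at (T x0))" using h by (simp add: isCont_def)
  qed
  moreover have "T x0 \<le> Tmax" if "x0 \<noteq> xs" for x0 using hit[OF that X] by blast
  ultimately show ?thesis using that by blast
qed

theorem fixed_time_stable_G: "fixed_time_stable G xs"
proof -
  obtain T where "settling_time G xs UNIV T" "\<And>x0. x0 \<noteq> xs \<Longrightarrow> T x0 \<le> Tmax"
    using settling_time_exists by blast
  then show ?thesis
    unfolding fixed_time_stable_def globally_finite_time_stable_def
    using lyapunov_stable_G by (auto intro!: exI[of _ T] bdd_aboveI[of _ Tmax])
qed

text \<open>A settling time guarantees avoidance only on a half-open interval, so the estimates are
  applied at every positive \<open>s < T x0\<close> and density gives the bound. This covers every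
  settling-time function, not only the first arrival.\<close>

theorem settling_time_bounds:
  assumes "settling_time G xs UNIV T" "x0 \<noteq> xs"
  shows "T x0 \<le> 1 / (p1 * (1 - (1 + \<kappa>1) / 2)) + 1 / (p2 * ((1 + \<kappa>2) / 2 - 1))"
    and "\<xi> > 0 \<Longrightarrow> (1 + \<kappa>1) / 2 = 1 - 1 / (2 * \<xi>) \<Longrightarrow> (1 + \<kappa>2) / 2 = 1 + 1 / (2 * \<xi>) \<Longrightarrow>
      T x0 \<le> pi * \<xi> / sqrt (p1 * p2)"
proof -
  obtain x where x: "ode_solution G x0 x" and T: "T x0 > 0" "\<And>t. t \<in> {0..<T x0} \<Longrightarrow> x t \<noteq> xs"
    using assms by (fastforce simp: settling_time_def)
  have avoid: "(x has_vector_derivative G (x t)) (at t within {0..s})" "x t \<noteq> xs"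
    if "t \<in> {0..s}" "s < T x0" for s t
    using that T(2)[of t] by (auto intro: ode_solution_within[OF x])
  have "s \<le> 1 / (p1 * (1 - (1 + \<kappa>1) / 2)) + 1 / (p2 * ((1 + \<kappa>2) / 2 - 1))" if "0 < s" "s < T x0" for s
    using avoidance_time_bounds(1)[where s = s and x = x] avoid that by force
  then show "T x0 \<le> 1 / (p1 * (1 - (1 + \<kappa>1) / 2)) + 1 / (p2 * ((1 + \<kappa>2) / 2 - 1))"
    using T(1) by (rule dense_le_bounded[rotated])
  assume \<xi>: "\<xi> > 0" "(1 + \<kappa>1) / 2 = 1 - 1 / (2 * \<xi>)" "(1 + \<kappa>2) / 2 = 1 + 1 / (2 * \<xi>)"
  have "s \<le> pi * \<xi> / sqrt (p1 * p2)" if "0 < s" "s < T x0" for s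
    using avoidance_time_bounds(2)[where s = s and x = x, OF _ _ _ \<xi>] avoid that by force
  then show "T x0 \<le> pi * \<xi> / sqrt (p1 * p2)"
    using T(1) by (rule dense_le_bounded[rotated])
qed

end

subsection \<open>The forward-backward system\<close>

text \<open>The forward step multiplies squared distances by at most
  \<open>1 - 2 * lam * \<mu>B + lam\<^sup>2 * L\<^sup>2\<close>, and the resolvent has Lipschitz
  constant \<open>1 / \<beta>\<close>. By the gap condition \<open>\<beta>\<^sup>2\<close> exceeds
  the former.\<close>

lemma forward_backward_contraction:
  fixes A :: "'a::euclidean_space \<Rightarrow> 'a set"
  assumes A: "maximal_mu_monotone \<mu>A A" and B: "mu_monotone \<mu>B (\<lambda>x. {B x})"
    and L: "L-lipschitz_on UNIV B" and lam: "lam > 0" "1 + lam * \<mu>A > 0"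
    and gap: "2 * (\<mu>A + \<mu>B) + lam * \<mu>A\<^sup>2 - lam * L\<^sup>2 > 0"
  obtains q where "0 \<le> q" "q < 1"
    "\<And>x y. norm (fb_map lam A B x - fb_map lam A B y) \<le> q * norm (x - y)"
proof -
  define \<beta> where "\<beta> = 1 + lam * \<mu>A"
  \<comment> \<open>Truncation at 0 makes \<open>sqrt k\<close> available without a sign
    argument.\<close>
  define k where "k = max 0 (1 - 2 * lam * \<mu>B + lam\<^sup>2 * L\<^sup>2)"
  have \<beta>: "\<beta> > 0" using lam by (simp add: \<beta>_def)
  have "\<beta>\<^sup>2 - (1 - 2 * lam * \<mu>B + lam\<^sup>2 * L\<^sup>2)
      = lam * (2 * (\<mu>A + \<mu>B) + lam * \<mu>A\<^sup>2 - lam * L\<^sup>2)"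
    by (simp add: \<beta>_def power2_eq_square algebra_simps)
  also have "\<dots> > 0" using lam gap by simp
  finally have k: "k < \<beta>\<^sup>2" "0 \<le> k" using \<beta> by (auto simp: k_def)
  have "norm (fb_map lam A B x - fb_map lam A B y) \<le> sqrt k / \<beta> * norm (x - y)" for x y
  proof -
    let ?w = "(x - lam *\<^sub>R B x) - (y - lam *\<^sub>R B y)"
    have "(norm ?w)\<^sup>2 = (norm (x - y))\<^sup>2 - 2 * lam * inner (x - y) (B x - B y) + lam\<^sup>2 * (norm (B x - B y))\<^sup>2"
      unfolding power2_norm_eq_inner
      by (simp add: inner_simps inner_commute power2_eq_square algebra_simps)
    also have "\<dots> \<le> (norm (x - y))\<^sup>2 - 2 * lam * (\<mu>B * (norm (x - y))\<^sup>2) + lam\<^sup>2 * (L * norm (x - y))\<^sup>2"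
    proof (intro add_mono diff_mono mult_left_mono power_mono)
      show "\<mu>B * (norm (x - y))\<^sup>2 \<le> inner (x - y) (B x - B y)"
        using B by (simp add: mu_monotone_def)
      show "norm (B x - B y) \<le> L * norm (x - y)"
        using L by (simp add: lipschitz_on_def dist_norm)
    qed (use lam in auto)
    also have "\<dots> = (1 - 2 * lam * \<mu>B + lam\<^sup>2 * L\<^sup>2) * (norm (x - y))\<^sup>2"
      by (simp add: algebra_simps power_mult_distrib)
    also have "\<dots> \<le> k * (norm (x - y))\<^sup>2" by (intro mult_right_mono) (auto simp: k_def)
    also have "\<dots> = (sqrt k * norm (x - y))\<^sup>2" using k by (simp add: power_mult_distrib)
    finally have "norm ?w \<le> sqrt k * norm (x - y)"
      by (rule power2_le_imp_le) (use k in auto)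
    moreover have "\<beta> * norm (fb_map lam A B x - fb_map lam A B y) \<le> norm ?w"
      using resolvent_lipschitz[OF A lam] by (simp add: fb_map_def \<beta>_def)
    ultimately show ?thesis using \<beta> by (simp add: field_simps)
  qed
  moreover have "sqrt k < \<beta>" using k \<beta> by (simp add: real_less_lsqrt)
  ultimately show ?thesis using that[of "sqrt k / \<beta>"] k \<beta> by simp
qed

text \<open>Cancelling \<open>x\<close> in the resolvent equation of a fixed point leaves
  \<open>lam *\<^sub>R (u + B x) = 0\<close> with \<open>u \<in> A x\<close>.\<close>

lemma zero_in_sum_iff_fb_map_fixed:
  fixes A :: "'a::euclidean_space \<Rightarrow> 'a set"
  assumes "maximal_mu_monotone \<mu> A" "lam > 0" "1 + lam * \<mu> > 0"
  shows "0 \<in> A x + {B x} \<longleftrightarrow> fb_map lam A B x = x"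
proof -
  have "fb_map lam A B x = x \<longleftrightarrow> (\<exists>u\<in>A x. x - lam *\<^sub>R B x = x + lam *\<^sub>R u)"
    using resolvent_eq_iff[OF assms] by (simp add: fb_map_def resolvent_set_def)
  also have "\<dots> \<longleftrightarrow> (\<exists>u\<in>A x. lam *\<^sub>R (u + B x) = 0)"
  proof (intro bex_cong refl)
    fix u
    have "(x + lam *\<^sub>R u) - (x - lam *\<^sub>R B x) = lam *\<^sub>R (u + B x)"
      by (simp add: algebra_simps)
    then show "x - lam *\<^sub>R B x = x + lam *\<^sub>R u \<longleftrightarrow> lam *\<^sub>R (u + B x) = 0"
      by (metis eq_iff_diff_eq_0)
  qed
  also have "\<dots> \<longleftrightarrow> 0 \<in> A x + {B x}"
    using assms(2) by (auto simp: set_plus_def intro: sym)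
  finally show ?thesis ..
qed

theorem theorem3p9:
  fixes A :: "'a::euclidean_space \<Rightarrow> 'a set"
    and B :: "'a \<Rightarrow> 'a"
    and \<mu>A \<mu>B L lam c1 c2 :: real
  assumes "L \<ge> 0"
    and "maximal_mu_monotone \<mu>A A"
    and "mu_monotone \<mu>B (\<lambda>x. {B x})"
    and "L-lipschitz_on UNIV B"
    and "lam > 0"
    and "1 + lam * \<mu>A > 0"
    and "2 * (\<mu>A + \<mu>B) + lam * \<mu>A\<^sup>2 - lam * L\<^sup>2 > 0"
    and "c1 > 0" and "c2 > 0"
  shows "\<exists>xs. (\<forall>x. 0 \<in> A x + {B x} \<longleftrightarrow> x = xs) \<and>
    (\<exists>\<epsilon>>0. \<forall>\<kappa>1 \<in> {1 - \<epsilon><..<1} \<inter> {0<..<1}. \<forall>\<kappa>2>1.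
       equilibrium_point (fb_field c1 c2 \<kappa>1 \<kappa>2 lam A B) xs \<and>
       fixed_time_stable (fb_field c1 c2 \<kappa>1 \<kappa>2 lam A B) xs \<and>
       (\<exists>p1>0. \<exists>p2>0. \<exists>\<alpha>1 \<in> {1/2<..<1}. \<exists>\<alpha>2>1.
          \<alpha>1 = (1 + \<kappa>1) / 2 \<and> \<alpha>2 = (1 + \<kappa>2) / 2 \<and>
          (\<forall>T. settling_time (fb_field c1 c2 \<kappa>1 \<kappa>2 lam A B) xs UNIV T \<longrightarrow>
             (\<forall>x0. x0 \<noteq> xs \<longrightarrow>
                T x0 \<le> 1 / (p1 * (1 - \<alpha>1)) + 1 / (p2 * (\<alpha>2 - 1))) \<and>
             (\<forall>\<xi>>1. \<alpha>1 = 1 - 1 / (2 * \<xi>) \<and> \<alpha>2 = 1 + 1 / (2 * \<xi>) \<longrightarrow>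
                (\<forall>x0. x0 \<noteq> xs \<longrightarrow> T x0 \<le> pi * \<xi> / sqrt (p1 * p2))))))"
proof -
  let ?S = "fb_map lam A B"
  let ?F = "\<lambda>x. x - ?S x"
  obtain q where q: "0 \<le> q" "q < 1" and contr: "\<And>x y. norm (?S x - ?S y) \<le> q * norm (x - y)"
    using forward_backward_contraction[OF assms(2-7)] by blast
  have "\<exists>!x. ?S x = x"
    using q contr by (intro banach_fix_type) (auto simp: dist_norm)
  then obtain xs where xs: "\<And>x. ?S x = x \<longleftrightarrow> x = xs" by auto
  \<comment> \<open>By Cauchy-Schwarz the contraction leaves \<open>Id - S\<close> strongly monotone
    with constant \<open>1 - q\<close>; its Lipschitz constant is at most \<open>1 + q\<close>,
    hence 2.\<close>
  have flow: "power_damped_flow ?F xs (1 - q) 2 c1 c2 \<kappa>1 \<kappa>2"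
    if "0 < \<kappa>1" "\<kappa>1 < 1" "1 < \<kappa>2" for \<kappa>1 \<kappa>2
  proof
    fix x y
    have "inner (x - y) (?S x - ?S y) \<le> norm (x - y) * norm (?S x - ?S y)" by (rule norm_cauchy_schwarz)
    also have "\<dots> \<le> norm (x - y) * (q * norm (x - y))" by (intro mult_left_mono contr) auto
    finally have "inner (x - y) (?S x - ?S y) \<le> q * (norm (x - y))\<^sup>2"
      by (simp add: power2_eq_square mult_ac)
    moreover have diff: "?F x - ?F y = (x - y) - (?S x - ?S y)" by simp
    ultimately show "(1 - q) * (norm (x - y))\<^sup>2 \<le> inner (x - y) (?F x - ?F y)"
      unfolding diff inner_diff_right[of _ "x - y"] power2_norm_eq_inner by (simp add: left_diff_distrib)
    have "norm (?F x - ?F y) \<le> norm (x - y) + norm (?S x - ?S y)"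
      unfolding diff by (rule norm_triangle_ineq4)
    moreover have "norm (?S x - ?S y) \<le> 1 * norm (x - y)"
      by (rule order_trans[OF contr mult_right_mono]) (use q in auto)
    ultimately show "norm (?F x - ?F y) \<le> 2 * norm (x - y)" by simp
  qed (use xs[of xs] q assms that in auto)
  have field: "fb_field c1 c2 \<kappa>1 \<kappa>2 lam A B = power_damped_flow.G ?F c1 c2 \<kappa>1 \<kappa>2"
    if "0 < \<kappa>1" "\<kappa>1 < 1" "1 < \<kappa>2" for \<kappa>1 \<kappa>2
  proof -
    interpret power_damped_flow ?F xs "1 - q" 2 c1 c2 \<kappa>1 \<kappa>2 using flow[OF that] .
    \<comment> \<open>This includes \<open>r = 0\<close>, where \<open>0 powr _ = 0\<close> and
      division by zero make both sides 0.\<close>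
    have "c / r powr (1 - k) = c * r powr (k - 1)" for c r k :: real
      by (metis minus_diff_eq powr_minus_divide times_divide_eq_right mult.right_neutral)
    then show ?thesis
      by (auto simp: fun_eq_iff fb_field_def fb_phi_def G_def gain_def Fix_def
          simp del: minus_add_distrib add_uminus_conv_diff)
  qed
  have zeros: "\<forall>x. 0 \<in> A x + {B x} \<longleftrightarrow> x = xs"
    using zero_in_sum_iff_fb_map_fixed[OF assms(2,5,6)] xs by metis
  show ?thesis
  proof (rule exI[of _ xs], rule conjI[OF zeros], rule exI[of _ 1], intro conjI ballI allI impI)
    fix \<kappa>1 \<kappa>2 :: real assume \<kappa>: "\<kappa>1 \<in> {1 - 1<..<1} \<inter> {0<..<1}" "1 < \<kappa>2"
    then have \<kappa>': "0 < \<kappa>1" "\<kappa>1 < 1" "1 < \<kappa>2" by auto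
    interpret power_damped_flow ?F xs "1 - q" 2 c1 c2 \<kappa>1 \<kappa>2 using flow[OF \<kappa>'] .
    note field = field[OF \<kappa>']
    show "equilibrium_point (fb_field c1 c2 \<kappa>1 \<kappa>2 lam A B) xs"
      unfolding field equilibrium_point_def by (simp add: continuous_on_G)
    show "fixed_time_stable (fb_field c1 c2 \<kappa>1 \<kappa>2 lam A B) xs"
      unfolding field by (rule fixed_time_stable_G)
    show "\<exists>p1>0. \<exists>p2>0. \<exists>\<alpha>1 \<in> {1/2<..<1}. \<exists>\<alpha>2>1.
          \<alpha>1 = (1 + \<kappa>1) / 2 \<and> \<alpha>2 = (1 + \<kappa>2) / 2 \<and>
          (\<forall>T. settling_time (fb_field c1 c2 \<kappa>1 \<kappa>2 lam A B) xs UNIV T \<longrightarrow>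
             (\<forall>x0. x0 \<noteq> xs \<longrightarrow>
                T x0 \<le> 1 / (p1 * (1 - \<alpha>1)) + 1 / (p2 * (\<alpha>2 - 1))) \<and>
             (\<forall>\<xi>>1. \<alpha>1 = 1 - 1 / (2 * \<xi>) \<and> \<alpha>2 = 1 + 1 / (2 * \<xi>) \<longrightarrow>
                (\<forall>x0. x0 \<noteq> xs \<longrightarrow> T x0 \<le> pi * \<xi> / sqrt (p1 * p2))))"
      unfolding field
      by (intro exI[of _ p1] exI[of _ p2] bexI[of _ "(1 + \<kappa>1) / 2"] exI[of _ "(1 + \<kappa>2) / 2"]
          conjI allI impI p_pos settling_time_bounds) (use \<kappa>' in auto)
  qed simp
qed

end
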